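(* Let $T=\{0,1/2,1/3,\ldots,1/n,\ldots\}$. Let $\{\lambda_j\}_{j\ge 2}$, $\{f_j\}_{j\ge 2}$, $\{g_j\}_{j\ge 2}$ be real sequences with $\lambda_j>0$, $0<f_j<1$, $0<g_j<1$ for all $j\ge 2$, $\lim_{n\to\infty}\lambda_n=0$, and $$\sum_{j=2}^{\infty}\frac{1-f_j}{\lambda_j}<1,\qquad \sum_{j=2}^{\infty}\frac{1-g_j}{\lambda_j}<1 .$$ Let $U$ be the kernel on $T$ defined by $U(0,0)=2$, $U(0,1/j)=1+g_j$, $U(1/i,0)=1+f_i$ and $U(1/i,1/j)=\lambda_i\delta_{i,j}+1+f_ig_j$ for $i,j\ge 2$. For $\alpha>0$ let $X_{(\alpha)}=\{X_{(\alpha),s},\,s\in T\}$ be an $\alpha$-permanental sequence with kernel $U$. If $$\lim_{n\to\infty}\lambda_n\log n=\beta,\qquad 0\le\beta<\infty,$$ then for all integers $k\ge 1$, almost surely, $$\limsup_{n\to\infty}\frac{|X_{(k/2),1/n}-X_{(k/2),0}|}{(\lambda_n\log n)^{1/2}}=\beta^{1/2}+2X_{(k/2),0}^{1/2},$$ $$\limsup_{n\to\infty}\frac{X_{(k/2),1/n}-X_{(k/2),0}}{(\lambda_n\log n)^{1/2}}=\beta^{1/2}+2X_{(k/2),0}^{1/2},$$ and $$\liminf_{n\to\infty}\frac{X_{(k/2),1/n}-X_{(k/2),0}}{(\lambda_n\log n)^{1/2}}=\begin{cases}-X_{(k/2),0}/\beta^{1/2}, & \text{if } X_{(k/2),0}<\beta,\\[2pt]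 \beta^{1/2}-2X_{(k/2),0}^{1/2}, & \text{if } X_{(k/2),0}\ge\beta.\end{cases}$$
   Context: An $\alpha$-permanental vector with kernel $K$ (an $n\times n$ matrix), $\alpha>0$, is a random vector $(X_1,\ldots,X_n)$ with values in $[0,\infty)^n$ such that for every diagonal matrix $S$ with non-negative diagonal entries $s_1,\ldots,s_n$, $$E\Big(e^{-\sum_{i=1}^n s_iX_i}\Big)=\frac{1}{|I+KS|^{\alpha}},$$ where $|\cdot|$ denotes the determinant. An $\alpha$-permanental process (sequence) on $T$ with kernel $\{K(s,t);s,t\in T\}$ is a stochastic process $\{X_t,t\in T\}$ such that for all distinct $t_1,\ldots,t_n\in T$, $(X_{t_1},\ldots,X_{t_n})$ is an $\alpha$-permanental vector with kernel $\{K(t_i,t_j)\}_{i,j=1}^n$. For the kernel $U$ of the claim, such a sequence exists for every $\alpha>0$. *)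

theory Defs
  imports "HOL-Probability.Probability" "Jordan_Normal_Form.Determinant"
begin

text \<open>
  \<open>det\<close> is the determinant of \<open>n \<times> n\<close> matrices over an explicit dimension \<open>n\<close>; it is written
  qualified to separate it from the type-indexed one of HOL-Analysis. The real power is \<open>powr\<close>.
  Its values at non-positive bases play no role: the Laplace transform on the left is positive
  while \<open>0 powr \<alpha> = 0\<close>, so the determinant never vanishes, and being continuous in
  \<open>s\<close> and equal to 1 at \<open>s = 0\<close> it is positive on the whole (connected) orthant.
\<close>

definition (in prob_space) permanental_vector ::
  "real \<Rightarrow> nat \<Rightarrow> real mat \<Rightarrow> (nat \<Rightarrow> 'a \<Rightarrow> real) \<Rightarrow> bool" where
  "permanental_vector \<alpha> n K X \<longleftrightarrow>
     \<alpha> > 0 \<and> K \<in> carrier_mat n n \<and>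
     (\<forall>i<n. random_variable borel (X i) \<and> (\<forall>\<omega>\<in>space M. 0 \<le> X i \<omega>)) \<and>
     (\<forall>s. (\<forall>i<n. 0 \<le> s i) \<longrightarrow>
        expectation (\<lambda>\<omega>. exp (- (\<Sum>i<n. s i * X i \<omega>))) =
          1 / Determinant.det (1\<^sub>m n + K * mat_diag n s) powr \<alpha>)"

definition (in prob_space) permanental_process ::
  "real \<Rightarrow> 't set \<Rightarrow> ('t \<Rightarrow> 't \<Rightarrow> real) \<Rightarrow> ('t \<Rightarrow> 'a \<Rightarrow> real) \<Rightarrow> bool" where
  "permanental_process \<alpha> T K X \<longleftrightarrow>
     (\<forall>n t. 1 \<le> n \<longrightarrow> inj_on t {..<n} \<longrightarrow> t ` {..<n} \<subseteq> T \<longrightarrow>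
        permanental_vector \<alpha> n (mat n n (\<lambda>(i, j). K (t i) (t j))) (\<lambda>i. X (t i)))"

end

theory Submission
  imports Defs
begin

text \<open>
  If all \<open>f j\<close> and \<open>g j\<close> were 1, the process would be \<open>X 0 = |z|\<^sup>2 / 2\<close> and
  \<open>X (1/n) = |sqrt (l n) \<xi> n + z|\<^sup>2 / 2\<close> for a Gaussian vector \<open>z\<close> in dimension \<open>k\<close> with covariance
  \<open>2 I\<close> and independent standard Gaussian vectors \<open>\<xi> n\<close>. There the limits follow from Borel-Cantelli:
  for fixed \<open>z\<close> the cluster set of \<open>\<xi> n / sqrt (ln n)\<close> is the ball of radius \<open>sqrt 2\<close>, and the three
  limits are extreme values of \<open>w \<bullet> z + sqrt \<beta> |w|\<^sup>2 / 2\<close> over this ball.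

  In general the determinant is explicit, because the kernel is diagonal plus rank two. For the
  indices \<open>0\<close> and \<open>n > m\<close> it shows that the Laplace transform of the process is that of the Gaussian
  model times \<open>(1 + W) powr (- k/2)\<close>, where \<open>W\<close> is a combination of Laplace transforms of probability
  measures whose coefficients are small by the summability of \<open>(1 - f j) / l j\<close> and
  \<open>(1 - g j) / l j\<close>. Hence the two laws restricted to these indices differ in total variation by some
  \<open>\<epsilon> m\<close> tending to 0. The event in question depends on these indices only, for every \<open>m\<close>, and so it
  has the same probability in both models.
\<close>

section \<open>Determinant of a diagonal plus rank two kernel\<close>

text \<open>The kernel need not be symmetric, so no Gaussian process behind \<open>X\<close> is at
  hand: all that is given are finite-dimensional Laplace transforms. The event involves infinitely
  many coordinates, so the comparison with the Gaussian model needs an error bound that does not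
  grow with their number. This is why every estimate is made in a norm on functionals whose
  constants depend on the tail sums only. The quotient of the two determinants contains sums that
  are unbounded in \<open>s\<close>. The proof works because the dangerous products cancel, which
  leaves \<open>W\<close> with norm at most \<open>10 * \<delta>\<close>, where
  \<open>\<delta>\<close> bounds the two tail sums. The binomial series then turns this into the
  error \<open>(1 - 10 * \<delta>) powr (- \<alpha>) - 1\<close>. The coordinate \<open>0\<close>
  occurs in the event and is kept when small indices are dropped. It does no harm: there the roles
  of \<open>f\<close> and \<open>g\<close> are played by the exact value 1, so it contributes
  nothing to \<open>W\<close> except through the bounded factor \<open>1 / D\<close>.\<close>

lemma det_one_plus_mult_commute:
  fixes A B :: "real mat"
  assumes A: "A \<in> carrier_mat n m" and B: "B \<in> carrier_mat m n"
  shows "Determinant.det (1\<^sub>m n + A * B) = Determinant.det (1\<^sub>m m + B * A)"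
proof -
  \<comment> \<open>Sylvester's identity: the unitriangular factors \<open>?L\<close> and
    \<open>?R\<close> make \<open>?M\<close> block triangular in two ways, with
    \<open>1 + A * B\<close> and \<open>1 + B * A\<close> as the only nontrivial diagonal
    blocks.\<close>
  let ?M = "four_block_mat (1\<^sub>m n) (- A) B (1\<^sub>m m)"
  let ?L = "four_block_mat (1\<^sub>m n) A (0\<^sub>m m n) (1\<^sub>m m)"
  let ?R = "four_block_mat (1\<^sub>m n) (0\<^sub>m n m) (- B) (1\<^sub>m m)"
  have c: "?M \<in> carrier_mat (n + m) (n + m)" "?L \<in> carrier_mat (n + m) (n + m)"
    "?R \<in> carrier_mat (n + m) (n + m)"
    using A B by auto
  have mA: "- A \<in> carrier_mat n m" and mB: "- B \<in> carrier_mat m n" using A B by auto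
  have "?L * ?M = four_block_mat (1\<^sub>m n + A * B) (0\<^sub>m n m) B (1\<^sub>m m)"
    by (subst mult_four_block_mat[of _ n n _ m _ m _ _ n _ m]) (use A B in auto)
  then have L: "Determinant.det (?L * ?M) = Determinant.det (1\<^sub>m n + A * B)"
    using A B by (simp add: det_four_block_mat_upper_right_zero[of _ n _ m])
  have "?R * ?M = four_block_mat (1\<^sub>m n) (- A) (0\<^sub>m m n) (1\<^sub>m m + B * A)"
    by (subst mult_four_block_mat[of _ n n _ m _ m _ _ n _ m])
      (use A B in \<open>auto simp: comm_add_mat[of "B * A" m m]\<close>)
  then have R: "Determinant.det (?R * ?M) = Determinant.det (1\<^sub>m m + B * A)"
    using A B by (simp add: det_four_block_mat_lower_left_zero[of _ n _ m])
  have "Determinant.det ?L = 1" "Determinant.det ?R = 1"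
    using A B by (simp_all add: det_four_block_mat_lower_left_zero[of _ n _ m]
      det_four_block_mat_upper_right_zero[of _ n _ m])
  then show ?thesis
    using L R det_mult[OF c(2) c(1)] det_mult[OF c(3) c(1)] by simp
qed

lemma det_mat_2:
  "Determinant.det (Matrix.mat 2 2 f) = f (0, 0) * f (1, 1) - f (0, 1) * (f (1, 0) :: real)"
proof -
  let ?m = "\<lambda>x :: real. Matrix.mat 1 1 (\<lambda>_. x)"
  have mult: "?m x * ?m y = ?m (x * y)" for x y
    by (rule eq_matI) (auto simp: scalar_prod_def)
  have "Determinant.det (Matrix.mat 2 2 f) = Determinant.det (four_block_mat (?m (f (0, 0))) (?m (f (0, 1))) (?m (f (1, 0))) (?m (f (1, 1))))"
    by (rule arg_cong[of _ _ Determinant.det], rule eq_matI) (auto simp: less_Suc_eq numeral_2_eq_2)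
  also have "\<dots> = Determinant.det (?m (f (0, 0)) * ?m (f (1, 1)) - ?m (f (0, 1)) * ?m (f (1, 0)))"
    by (rule det_four_block_mat[of _ 1]) (simp_all only: mult mult.commute, simp_all)
  also have "\<dots> = f (0, 0) * f (1, 1) - f (0, 1) * f (1, 0)"
    unfolding mult by (subst det_single) auto
  finally show ?thesis .
qed

text \<open>The constant 1 and \<open>F i * G j\<close> have rank one each. Once the invertible
  diagonal factor \<open>1 + L i * s i\<close> is pulled out, the rest is the identity plus a
  product through dimension 2, and Sylvester's identity reduces it to a determinant of size 2 whose
  entries are sums weighted by \<open>a\<close>.\<close>

lemma det_one_plus_rank_two_kernel:
  fixes L F G s :: "nat \<Rightarrow> real" and n :: nat
  assumes d: "\<And>i. i < n \<Longrightarrow> 1 + L i * s i \<noteq> 0"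
  defines "a \<equiv> \<lambda>i. s i / (1 + L i * s i)"
  shows "Determinant.det (1\<^sub>m n
      + Matrix.mat n n (\<lambda>(i, j). L i * (if i = j then 1 else 0) + 1 + F i * G j) * mat_diag n s) =
    (\<Prod>i<n. 1 + L i * s i) *
    ((1 + (\<Sum>i<n. a i)) * (1 + (\<Sum>i<n. a i * F i * G i))
      - (\<Sum>i<n. a i * F i) * (\<Sum>i<n. a i * G i))"
proof -
  let ?E = "mat_diag n (\<lambda>i. 1 + L i * s i)"
  let ?A = "Matrix.mat n 2 (\<lambda>(i, c). (if c = 0 then 1 else F i) / (1 + L i * s i))"
  let ?B = "Matrix.mat 2 n (\<lambda>(c, j). (if c = 0 then 1 else G j) * s j)"
  have AB: "?A * ?B = Matrix.mat n n (\<lambda>(i, j). (1 + F i * G j) * s j / (1 + L i * s i))"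
    by (rule eq_matI) (auto simp: scalar_prod_def numeral_2_eq_2 add_divide_distrib algebra_simps)
  have BA: "1\<^sub>m 2 + ?B * ?A = Matrix.mat 2 2 (\<lambda>(c, c'). (if c = c' then 1 else 0) +
      (\<Sum>i<n. (if c = 0 then 1 else G i) * (if c' = 0 then 1 else F i) * a i))"
    by (rule eq_matI)
      (auto simp: scalar_prod_def a_def atLeast0LessThan intro!: sum.cong split: if_splits)
  have eq: "1\<^sub>m n + Matrix.mat n n (\<lambda>(i, j). L i * (if i = j then 1 else 0) + 1 + F i * G j) * mat_diag n s
      = ?E * (1\<^sub>m n + ?A * ?B)"
  proof -
    have entry: "(if i = j then 1 else 0) + (L i * (if i = j then 1 else 0) + 1 + F i * G j) * s j
        = (1 + L i * s i) * ((if i = j then 1 else 0) + (1 + F i * G j) * s j / (1 + L i * s i))"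
      if "i < n" for i j
    proof -
      define e where "e = 1 + L i * s i"
      have "e \<noteq> 0" using d[OF that] by (simp add: e_def)
      then have "e * ((if i = j then 1 else 0) + (1 + F i * G j) * s j / e)
          = e * (if i = j then 1 else 0) + (1 + F i * G j) * s j"
        by (simp add: distrib_left)
      then show ?thesis by (simp add: e_def algebra_simps)
    qed
    show ?thesis
      unfolding AB
    proof (subst mat_diag_mult_right[of _ n n], simp, subst mat_diag_mult_left[of _ n n], simp, rule eq_matI)
      fix i j
      assume "i < dim_row (Matrix.mat n n (\<lambda>(i, j). (1 + L i * s i) *
          (1\<^sub>m n + Matrix.mat n n (\<lambda>(i, j). (1 + F i * G j) * s j / (1 + L i * s i))) $$ (i, j)))"
        and "j < dim_col (Matrix.mat n n (\<lambda>(i, j). (1 + L i * s i) *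
          (1\<^sub>m n + Matrix.mat n n (\<lambda>(i, j). (1 + F i * G j) * s j / (1 + L i * s i))) $$ (i, j)))"
      then have ij: "i < n" "j < n" by auto
      show "(1\<^sub>m n + Matrix.mat n n (\<lambda>(i, j). Matrix.mat n n (\<lambda>(i, j). L i * (if i = j then 1 else 0)
              + 1 + F i * G j) $$ (i, j) * s j)) $$ (i, j)
          = Matrix.mat n n (\<lambda>(i, j). (1 + L i * s i) *
            (1\<^sub>m n + Matrix.mat n n (\<lambda>(i, j). (1 + F i * G j) * s j / (1 + L i * s i))) $$ (i, j)) $$ (i, j)"
        using ij entry[OF ij(1), of j] by simp
    qed simp_all
  qed
  have d1: "Determinant.det (?E * (1\<^sub>m n + ?A * ?B)) = Determinant.det ?E * Determinant.det (1\<^sub>m n + ?A * ?B)"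
    by (rule det_mult[of _ n]) auto
  have d2: "Determinant.det (1\<^sub>m n + ?A * ?B) = Determinant.det (1\<^sub>m 2 + ?B * ?A)"
    by (rule det_one_plus_mult_commute[of ?A n 2 ?B]) (rule mat_carrier)+
  have d3: "Determinant.det ?E = (\<Prod>i<n. 1 + L i * s i)"
    by (subst det_upper_triangular[of _ n])
      (auto simp: prod_list_diag_prod mat_diag_def atLeast0LessThan upper_triangular_def)
  show ?thesis unfolding eq d1 d2 d3 BA det_mat_2
    by (simp add: mult.commute mult.left_commute)
qed

section \<open>The Banach algebra of Laplace functionals\<close>

definition monom_val :: "nat \<Rightarrow> (nat \<Rightarrow> nat) \<Rightarrow> (nat \<Rightarrow> real) \<Rightarrow> real" where
  "monom_val n s y = (\<Prod>i<n. y i ^ s i)"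

text \<open>All coordinates are constrained although \<open>monom_val n\<close> reads only the first
  \<open>n\<close>: one compact space then serves every \<open>n\<close>.\<close>

definition unit_cube :: "(nat \<Rightarrow> real) set" where
  "unit_cube = {y. \<forall>i. 0 \<le> y i \<and> y i \<le> 1}"

text \<open>The norm of \<open>\<phi>\<close> as a functional on polynomials with the sup norm, where \<open>\<phi> s\<close> is the value
  on the monomial with exponents \<open>s\<close>. Laplace transforms evaluated at natural numbers are such
  functionals through \<open>y i = exp (- Y i)\<close>, and the functions of finite norm form a Banach algebra:
  this replaces signed measures and their convolution.\<close>

definition dual_bounded :: "nat \<Rightarrow> real \<Rightarrow> ((nat \<Rightarrow> nat) \<Rightarrow> real) \<Rightarrow> bool" where
  "dual_bounded n C \<phi> \<longleftrightarrow> 0 \<le> C \<and>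
     (\<forall>ps B. (\<forall>y\<in>unit_cube. \<bar>\<Sum>(c, s)\<leftarrow>ps. c * monom_val n s y\<bar> \<le> B)
        \<longrightarrow> \<bar>\<Sum>(c, s)\<leftarrow>ps. c * \<phi> s\<bar> \<le> C * B)"

lemma dual_boundedI:
  assumes "0 \<le> C"
    and "\<And>ps B. (\<And>y. y \<in> unit_cube \<Longrightarrow> \<bar>\<Sum>(c, s)\<leftarrow>ps. c * monom_val n s y\<bar> \<le> B) \<Longrightarrow>
      \<bar>\<Sum>(c, s)\<leftarrow>ps. c * \<phi> s\<bar> \<le> C * B"
  shows "dual_bounded n C \<phi>"
  using assms by (auto simp: dual_bounded_def)

lemma dual_boundedD:
  assumes "dual_bounded n C \<phi>"
    and "\<And>y. y \<in> unit_cube \<Longrightarrow> \<bar>\<Sum>(c, s)\<leftarrow>ps. c * monom_val n s y\<bar> \<le> B"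
  shows "\<bar>\<Sum>(c, s)\<leftarrow>ps. c * \<phi> s\<bar> \<le> C * B"
  using assms by (auto simp: dual_bounded_def)

lemma dual_bounded_nonneg: "dual_bounded n C \<phi> \<Longrightarrow> 0 \<le> C"
  by (simp add: dual_bounded_def)

lemma unit_cube_one: "(\<lambda>_. 1) \<in> unit_cube"
  by (simp add: unit_cube_def)

lemma unit_cube_mult: "y \<in> unit_cube \<Longrightarrow> z \<in> unit_cube \<Longrightarrow> (\<lambda>i. y i * z i) \<in> unit_cube"
  by (auto simp: unit_cube_def mult_le_one)

lemma monom_val_mult: "monom_val n s (\<lambda>i. y i * z i) = monom_val n s y * monom_val n s z"
  by (simp add: monom_val_def power_mult_distrib prod.distrib)

lemma monom_val_add: "monom_val n (\<lambda>i. s i + t i) y = monom_val n s y * monom_val n t y"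
  by (simp add: monom_val_def power_add prod.distrib)

lemma sum_list_case_add:
  fixes \<phi> \<psi> :: "'b \<Rightarrow> real"
  shows "(\<Sum>(c, s)\<leftarrow>ps. c * (\<phi> s + \<psi> s)) = (\<Sum>(c, s)\<leftarrow>ps. c * \<phi> s) + (\<Sum>(c, s)\<leftarrow>ps. c * \<psi> s)"
  by (induction ps) (auto simp: algebra_simps)

lemma sum_list_case_scale:
  fixes \<phi> :: "'b \<Rightarrow> real"
  shows "(\<Sum>(c, s)\<leftarrow>ps. c * (a * \<phi> s)) = a * (\<Sum>(c, s)\<leftarrow>ps. c * \<phi> s)"
  by (induction ps) (auto simp: algebra_simps)

lemma dual_bounded_mono: "dual_bounded n C \<phi> \<Longrightarrow> C \<le> D \<Longrightarrow> dual_bounded n D \<phi>"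
proof (rule dual_boundedI)
  assume "dual_bounded n C \<phi>" "C \<le> D"
  then show "0 \<le> D" using dual_bounded_nonneg by force
  fix ps B assume h: "\<And>y. y \<in> unit_cube \<Longrightarrow> \<bar>\<Sum>(c, s)\<leftarrow>ps. c * monom_val n s y\<bar> \<le> B"
  have "0 \<le> B" using h[OF unit_cube_one] by linarith
  then have "C * B \<le> D * B" using \<open>C \<le> D\<close> by (simp add: mult_right_mono)
  then show "\<bar>\<Sum>(c, s)\<leftarrow>ps. c * \<phi> s\<bar> \<le> D * B"
    using dual_boundedD[OF \<open>dual_bounded n C \<phi>\<close> h] by fastforce
qed

lemma dual_bounded_add:
  assumes "dual_bounded n C \<phi>" "dual_bounded n D \<psi>"
  shows "dual_bounded n (C + D) (\<lambda>s. \<phi> s + \<psi> s)"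
proof (rule dual_boundedI)
  show "0 \<le> C + D" using assms[THEN dual_bounded_nonneg] by simp
  fix ps B assume h: "\<And>y. y \<in> unit_cube \<Longrightarrow> \<bar>\<Sum>(c, s)\<leftarrow>ps. c * monom_val n s y\<bar> \<le> B"
  show "\<bar>\<Sum>(c, s)\<leftarrow>ps. c * (\<phi> s + \<psi> s)\<bar> \<le> (C + D) * B"
    unfolding sum_list_case_add
    using dual_boundedD[OF assms(1) h] dual_boundedD[OF assms(2) h]
    by (simp add: distrib_right)
qed

lemma dual_bounded_scale:
  assumes "dual_bounded n C \<phi>"
  shows "dual_bounded n (\<bar>a\<bar> * C) (\<lambda>s. a * \<phi> s)"
proof (rule dual_boundedI)
  show "0 \<le> \<bar>a\<bar> * C" using assms[THEN dual_bounded_nonneg] by simp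
  fix ps B assume h: "\<And>y. y \<in> unit_cube \<Longrightarrow> \<bar>\<Sum>(c, s)\<leftarrow>ps. c * monom_val n s y\<bar> \<le> B"
  show "\<bar>\<Sum>(c, s)\<leftarrow>ps. c * (a * \<phi> s)\<bar> \<le> \<bar>a\<bar> * C * B"
    unfolding sum_list_case_scale
    using dual_boundedD[OF assms(1) h] by (simp add: abs_mult mult.assoc mult_left_mono)
qed

lemma dual_bounded_diff:
  assumes "dual_bounded n C \<phi>" "dual_bounded n D \<psi>"
  shows "dual_bounded n (C + D) (\<lambda>s. \<phi> s - \<psi> s)"
  using dual_bounded_add[OF assms(1) dual_bounded_scale[OF assms(2), of "-1"]] by simp

text \<open>This is convolution of measures. The cube is closed under coordinatewise products, so
  for fixed \<open>y\<close> a polynomial evaluated at the product of \<open>y\<close> and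
  \<open>z\<close> is a polynomial in \<open>z\<close> with the same bound. Applying
  \<open>\<psi>\<close> leaves a polynomial in \<open>y\<close> bounded by \<open>D * B\<close>, to
  which \<open>\<phi>\<close> applies.\<close>

lemma dual_bounded_mult:
  assumes "dual_bounded n C \<phi>" "dual_bounded n D \<psi>"
  shows "dual_bounded n (C * D) (\<lambda>s. \<phi> s * \<psi> s)"
proof (rule dual_boundedI)
  show "0 \<le> C * D" using assms[THEN dual_bounded_nonneg] by simp
  fix ps B assume h: "\<And>y. y \<in> unit_cube \<Longrightarrow> \<bar>\<Sum>(c, s)\<leftarrow>ps. c * monom_val n s y\<bar> \<le> B"
  have 1: "\<bar>\<Sum>(c, s)\<leftarrow>map (\<lambda>(c, s). (c * \<psi> s, s)) ps. c * monom_val n s y\<bar> \<le> D * B"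
    if y: "y \<in> unit_cube" for y
  proof -
    have "\<bar>\<Sum>(c, s)\<leftarrow>map (\<lambda>(c, s). (c * monom_val n s y, s)) ps. c * \<psi> s\<bar> \<le> D * B"
    proof (rule dual_boundedD[OF assms(2)])
      fix z assume z: "z \<in> unit_cube"
      have "(\<Sum>(c, s)\<leftarrow>map (\<lambda>(c, s). (c * monom_val n s y, s)) ps. c * monom_val n s z)
          = (\<Sum>(c, s)\<leftarrow>ps. c * monom_val n s (\<lambda>i. y i * z i))"
        unfolding monom_val_mult by (induction ps) auto
      then show "\<bar>\<Sum>(c, s)\<leftarrow>map (\<lambda>(c, s). (c * monom_val n s y, s)) ps. c * monom_val n s z\<bar> \<le> B"
        using h[OF unit_cube_mult[OF y z]] by simp
    qed
    moreover have "(\<Sum>(c, s)\<leftarrow>map (\<lambda>(c, s). (c * monom_val n s y, s)) ps. c * \<psi> s)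
        = (\<Sum>(c, s)\<leftarrow>map (\<lambda>(c, s). (c * \<psi> s, s)) ps. c * monom_val n s y)"
      by (induction ps) auto
    ultimately show ?thesis by simp
  qed
  have "(\<Sum>(c, s)\<leftarrow>map (\<lambda>(c, s). (c * \<psi> s, s)) ps. c * \<phi> s) = (\<Sum>(c, s)\<leftarrow>ps. c * (\<phi> s * \<psi> s))"
    by (induction ps) auto
  then show "\<bar>\<Sum>(c, s)\<leftarrow>ps. c * (\<phi> s * \<psi> s)\<bar> \<le> C * D * B"
    using dual_boundedD[OF assms(1) 1] by (simp add: mult.assoc)
qed

text \<open>The constant 1 is evaluation at the point with all coordinates 1, that is, the law of
  \<open>Y = 0\<close>.\<close>

lemma dual_bounded_const: "dual_bounded n \<bar>c\<bar> (\<lambda>_. c)"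
proof -
  have "dual_bounded n 1 (\<lambda>_. 1)"
  proof (rule dual_boundedI)
    fix ps B assume "\<And>y. y \<in> unit_cube \<Longrightarrow> \<bar>\<Sum>(c, s)\<leftarrow>ps. c * monom_val n s y\<bar> \<le> B"
    from this[OF unit_cube_one] show "\<bar>\<Sum>(c, s)\<leftarrow>ps. c * 1\<bar> \<le> 1 * B"
      by (simp add: monom_val_def)
  qed simp
  from dual_bounded_scale[OF this, of c] show ?thesis by simp
qed

lemma dual_bounded_sum:
  assumes "\<And>i. i \<in> I \<Longrightarrow> dual_bounded n (C i) (\<phi> i)"
  shows "dual_bounded n (\<Sum>i\<in>I. C i) (\<lambda>s. \<Sum>i\<in>I. \<phi> i s)"
  using assms
proof (induction I rule: infinite_finite_induct)
  case (insert i I)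
  then show ?case using dual_bounded_add[of n "C i" "\<phi> i"] by simp
qed (use dual_bounded_const[of n 0] in auto)

lemma dual_bounded_power:
  assumes "dual_bounded n C \<phi>"
  shows "dual_bounded n (C ^ j) (\<lambda>s. \<phi> s ^ j)"
  by (induction j) (use dual_bounded_const[of n 1] dual_bounded_mult[OF assms] in auto)

text \<open>A polynomial has finitely many terms, so pointwise convergence in the exponents is
  enough for its image to converge.\<close>

lemma dual_bounded_lim:
  assumes "\<And>j. dual_bounded n C (\<phi> j)" "\<And>s. (\<lambda>j. \<phi> j s) \<longlonglongrightarrow> \<psi> s"
  shows "dual_bounded n C \<psi>"
proof (rule dual_boundedI)
  show "0 \<le> C" using assms(1)[THEN dual_bounded_nonneg] .
  fix ps B assume h: "\<And>y. y \<in> unit_cube \<Longrightarrow> \<bar>\<Sum>(c, s)\<leftarrow>ps. c * monom_val n s y\<bar> \<le> B"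
  have "(\<lambda>j. \<Sum>(c, s)\<leftarrow>ps. c * \<phi> j s) \<longlonglongrightarrow> (\<Sum>(c, s)\<leftarrow>ps. c * \<psi> s)"
    by (induction ps) (auto intro!: tendsto_intros assms(2))
  then have "(\<lambda>j. \<bar>\<Sum>(c, s)\<leftarrow>ps. c * \<phi> j s\<bar>) \<longlonglongrightarrow> \<bar>\<Sum>(c, s)\<leftarrow>ps. c * \<psi> s\<bar>"
    by (rule tendsto_rabs)
  then show "\<bar>\<Sum>(c, s)\<leftarrow>ps. c * \<psi> s\<bar> \<le> C * B"
    by (rule LIMSEQ_le_const2) (use dual_boundedD[OF assms(1) h] in auto)
qed

lemma dual_bounded_power_series:
  assumes "dual_bounded n r \<phi>" and "(\<lambda>j. \<bar>b j\<bar> * r ^ j) sums D"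
    and "\<And>s. (\<lambda>j. b j * \<phi> s ^ j) sums \<psi> s"
  shows "dual_bounded n D \<psi>"
proof (rule dual_bounded_lim)
  have r: "0 \<le> r" using assms(1) dual_bounded_nonneg by auto
  fix N
  have "dual_bounded n (\<Sum>j<N. \<bar>b j\<bar> * r ^ j) (\<lambda>s. \<Sum>j<N. b j * \<phi> s ^ j)"
    by (intro dual_bounded_sum dual_bounded_scale dual_bounded_power assms(1))
  moreover have "(\<Sum>j<N. \<bar>b j\<bar> * r ^ j) \<le> D"
    using assms(2) sums_unique[OF assms(2)] r by (auto intro!: sum_le_suminf sums_summable)
  ultimately show "dual_bounded n D (\<lambda>s. \<Sum>j<N. b j * \<phi> s ^ j)"
    by (rule dual_bounded_mono)
qed (use assms(3) in \<open>auto simp: sums_def\<close>)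

section \<open>Laplace transforms as functionals of norm one\<close>

lemma (in finite_measure) integrable_monom_val_exp:
  assumes "\<And>i. i < n \<Longrightarrow> Y i \<in> borel_measurable M" "\<And>i \<omega>. \<omega> \<in> space M \<Longrightarrow> 0 \<le> Y i \<omega>"
  shows "integrable M (\<lambda>\<omega>. monom_val n s (\<lambda>i. exp (- Y i \<omega>)))"
proof (rule integrable_const_bound[where B = 1])
  show "AE \<omega> in M. norm (monom_val n s (\<lambda>i. exp (- Y i \<omega>))) \<le> 1"
    using assms(2) by (auto simp: monom_val_def abs_prod intro!: prod_le_1 power_le_one)
  show "(\<lambda>\<omega>. monom_val n s (\<lambda>i. exp (- Y i \<omega>))) \<in> borel_measurable M"
    unfolding monom_val_def using assms(1) by measurable
qed

lemma (in finite_measure) integral_poly: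
  assumes "\<And>s. integrable M (\<lambda>\<omega>. monom_val n s (Z \<omega>))"
  shows "integrable M (\<lambda>\<omega>. \<Sum>(c, s)\<leftarrow>ps. c * monom_val n s (Z \<omega>))"
    and "(\<Sum>(c, s)\<leftarrow>ps. c * (\<integral>\<omega>. monom_val n s (Z \<omega>) \<partial>M)) =
      (\<integral>\<omega>. (\<Sum>(c, s)\<leftarrow>ps. c * monom_val n s (Z \<omega>)) \<partial>M)"
proof -
  have "integrable M (\<lambda>\<omega>. \<Sum>(c, s)\<leftarrow>ps. c * monom_val n s (Z \<omega>)) \<and> 
   (\<Sum>(c, s)\<leftarrow>ps. c * (\<integral>\<omega>. monom_val n s (Z \<omega>) \<partial>M)) =
      (\<integral>\<omega>. (\<Sum>(c, s)\<leftarrow>ps. c * monom_val n s (Z \<omega>)) \<partial>M)"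
    by (induction ps) (use assms in auto)
  then show "integrable M (\<lambda>\<omega>. \<Sum>(c, s)\<leftarrow>ps. c * monom_val n s (Z \<omega>))"
    and "(\<Sum>(c, s)\<leftarrow>ps. c * (\<integral>\<omega>. monom_val n s (Z \<omega>) \<partial>M)) =
      (\<integral>\<omega>. (\<Sum>(c, s)\<leftarrow>ps. c * monom_val n s (Z \<omega>)) \<partial>M)" by auto
qed

lemma (in prob_space) dual_bounded_laplace:
  assumes "\<And>i. i < n \<Longrightarrow> Y i \<in> borel_measurable M" "\<And>i \<omega>. \<omega> \<in> space M \<Longrightarrow> 0 \<le> Y i \<omega>"
  shows "dual_bounded n 1 (\<lambda>s. \<integral>\<omega>. monom_val n s (\<lambda>i. exp (- Y i \<omega>)) \<partial>M)"
proof (rule dual_boundedI)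
  fix ps B assume h: "\<And>y. y \<in> unit_cube \<Longrightarrow> \<bar>\<Sum>(c, s)\<leftarrow>ps. c * monom_val n s y\<bar> \<le> B"
  have le: "\<bar>\<Sum>(c, s)\<leftarrow>ps. c * monom_val n s (\<lambda>i. exp (- Y i \<omega>))\<bar> \<le> B" if "\<omega> \<in> space M" for \<omega>
    by (rule h) (use assms(2) that in \<open>auto simp: unit_cube_def\<close>)
  note int = integral_poly[of n "\<lambda>\<omega> i. exp (- Y i \<omega>)", OF integrable_monom_val_exp[of n Y, OF assms]]
  have "\<bar>\<integral>\<omega>. (\<Sum>(c, s)\<leftarrow>ps. c * monom_val n s (\<lambda>i. exp (- Y i \<omega>))) \<partial>M\<bar>
      \<le> (\<integral>\<omega>. \<bar>\<Sum>(c, s)\<leftarrow>ps. c * monom_val n s (\<lambda>i. exp (- Y i \<omega>))\<bar> \<partial>M)"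
    by (rule integral_abs_bound)
  also have "\<dots> \<le> (\<integral>\<omega>. B \<partial>M)"
    by (rule integral_mono) (use int(1) le in auto)
  finally show "\<bar>\<Sum>(c, s)\<leftarrow>ps. c * (\<integral>\<omega>. monom_val n s (\<lambda>i. exp (- Y i \<omega>)) \<partial>M)\<bar> \<le> 1 * B"
    using int(2)[of ps] by (simp add: prob_space)
qed simp

text \<open>The functional belongs to a probability measure: \<open>c\<close> times a standard
  exponential variable in coordinate \<open>i\<close>, and zero in the others.\<close>

lemma dual_bounded_exponential:
  assumes "i < n" "0 \<le> c"
  shows "dual_bounded n 1 (\<lambda>s. 1 / (1 + c * real (s i)))"
proof -
  interpret P: prob_space "density lborel (exponential_density 1)"
    by (rule prob_space_exponential_density) simp
  \<comment> \<open>The absolute value makes \<open>Y\<close> nonnegative on the whole line; the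
    exponential density vanishes on the negative axis.\<close>
  define Y where "Y = (\<lambda>j (x::real). if j = i then c * \<bar>x\<bar> else 0)"
  have Y: "Y j \<in> borel_measurable (density lborel (exponential_density 1))" "0 \<le> Y j x" for j x
    using assms(2) by (auto simp: Y_def)
  have "(\<integral>x. monom_val n s (\<lambda>i. exp (- Y i x)) \<partial>density lborel (exponential_density 1))
      = 1 / (1 + c * real (s i))" (is "?L = _") for s
  proof -
    let ?d = "1 + c * real (s i)"
    have d: "0 < ?d" using assms(2) by (simp add: add_pos_nonneg)
    have m: "monom_val n s (\<lambda>i. exp (- Y i x)) = exp (- (real (s i) * (c * \<bar>x\<bar>)))" for x
    proof -
      have "monom_val n s (\<lambda>i. exp (- Y i x))
          = (\<Prod>j<n. if j = i then exp (- (c * \<bar>x\<bar>)) ^ s i else 1)"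
        unfolding monom_val_def Y_def by (rule prod.cong) auto
      also have "\<dots> = exp (- (real (s i) * (c * \<bar>x\<bar>)))"
        using assms(1) by (simp add: prod.delta exp_of_nat_mult[symmetric])
      finally show ?thesis .
    qed
    have "?L = (\<integral>x. exponential_density 1 x * exp (- (real (s i) * (c * \<bar>x\<bar>))) \<partial>lborel)"
      unfolding m by (subst integral_real_density) (auto simp: exponential_density_nonneg)
    also have "\<dots> = (\<integral>x. 1 / ?d * exponential_density ?d x \<partial>lborel)"
    proof (rule Bochner_Integration.integral_cong)
      fix x :: real
      have "exp (- x) * exp (- (real (s i) * (c * x))) = exp (- x * ?d)"
        by (simp add: mult_exp_exp algebra_simps)
      then show "exponential_density 1 x * exp (- (real (s i) * (c * \<bar>x\<bar>)))
          = 1 / ?d * exponential_density ?d x"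
        using d by (auto simp: exponential_density_def)
    qed simp
    also have "\<dots> = 1 / ?d"
    proof -
      interpret Q: prob_space "density lborel (exponential_density ?d)"
        by (rule prob_space_exponential_density[OF d])
      have "(\<integral>x. 1 \<partial>density lborel (exponential_density ?d)) = (\<integral>x. exponential_density ?d x * 1 \<partial>lborel)"
        by (subst integral_real_density) (use d in \<open>auto simp: exponential_density_nonneg\<close>)
      then show ?thesis using Q.prob_space by simp
    qed
    finally show ?thesis .
  qed
  then show ?thesis using P.dual_bounded_laplace[of n Y, OF Y] by simp
qed

lemma dual_bounded_abs_le:
  assumes "dual_bounded n C \<phi>"
  shows "\<bar>\<phi> s\<bar> \<le> C"
proof -
  have "\<bar>\<Sum>(c, s)\<leftarrow>[(1, s)]. c * \<phi> s\<bar> \<le> C * 1"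
  proof (rule dual_boundedD[OF assms])
    fix y assume "y \<in> unit_cube"
    then show "\<bar>\<Sum>(c, s)\<leftarrow>[(1, s)]. c * monom_val n s y\<bar> \<le> 1"
      by (auto simp: monom_val_def unit_cube_def abs_prod intro!: prod_le_1 power_le_one)
  qed
  then show ?thesis by simp
qed

text \<open>Writing \<open>t i = 1 / (1 + L i * s i)\<close>, the affine function is \<open>1 + c + 2 * s 0\<close> minus a combination
  of the \<open>t i\<close> with nonnegative coefficients of sum \<open>c\<close>, so its inverse is a geometric series with
  nonnegative coefficients.\<close>

lemma dual_bounded_inverse_affine:
  fixes L :: "nat \<Rightarrow> real"
  assumes L0: "L 0 = 0" and L: "\<And>i. 0 < i \<Longrightarrow> 0 < L i" and n: "0 < n"
  shows "dual_bounded n 1 (\<lambda>s. 1 / (1 + 2 * (\<Sum>i<n. real (s i) / (1 + L i * real (s i)))))"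
proof -
  define c where "c = (\<Sum>i\<in>{1..<n}. 2 / L i)"
  define \<rho> where "\<rho> = (\<lambda>s :: nat \<Rightarrow> nat. 1 / (1 + c) * (1 / (1 + 2 / (1 + c) * real (s 0))))"
  define \<sigma> where "\<sigma> = (\<lambda>s :: nat \<Rightarrow> nat. \<Sum>i\<in>{1..<n}. 2 / L i * (1 / (1 + L i * real (s i))))"
  have c: "0 \<le> c" unfolding c_def by (intro sum_nonneg) (use L in \<open>auto intro: less_imp_le\<close>)
  have \<rho>: "dual_bounded n (1 / (1 + c)) \<rho>"
    unfolding \<rho>_def
    using dual_bounded_scale[OF dual_bounded_exponential[of 0 n "2 / (1 + c)"], of "1 / (1 + c)"] n c by simp
  have "dual_bounded n (\<Sum>i\<in>{1..<n}. \<bar>2 / L i\<bar> * 1) \<sigma>"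
    unfolding \<sigma>_def
    by (intro dual_bounded_sum dual_bounded_scale dual_bounded_exponential) (use L in \<open>auto intro: less_imp_le\<close>)
  also have "(\<Sum>i\<in>{1..<n}. \<bar>2 / L i\<bar> * 1) = c"
    unfolding c_def by (intro sum.cong) (use L in \<open>auto simp: abs_of_pos\<close>)
  finally have \<sigma>: "dual_bounded n c \<sigma>" .
  \<comment> \<open>Whatever the size of \<open>c\<close>, the ratio stays below 1. The geometric
    series costs the factor \<open>1 / (1 - r) = 1 + c\<close>, which cancels the norm
    \<open>1 / (1 + c)\<close> of \<open>\<rho>\<close>; hence the final bound 1, independent of
    \<open>L\<close> and \<open>n\<close>.\<close>
  define r where "r = 1 / (1 + c) * c"
  have r: "0 \<le> r" "r < 1" using c by (auto simp: r_def)
  have \<rho>\<sigma>: "dual_bounded n r (\<lambda>s. \<rho> s * \<sigma> s)"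
    unfolding r_def by (rule dual_bounded_mult[OF \<rho> \<sigma>])
  have "dual_bounded n (1 / (1 - r)) (\<lambda>s. 1 / (1 - \<rho> s * \<sigma> s))"
  proof (rule dual_bounded_power_series[OF \<rho>\<sigma>, of "\<lambda>_. 1"])
    show "(\<lambda>j. \<bar>1\<bar> * r ^ j) sums (1 / (1 - r))" using geometric_sums[of r] r by simp
    show "(\<lambda>j. 1 * (\<rho> s * \<sigma> s) ^ j) sums (1 / (1 - \<rho> s * \<sigma> s))" for s
      using geometric_sums[of "\<rho> s * \<sigma> s"] dual_bounded_abs_le[OF \<rho>\<sigma>, of s] r by simp
  qed
  from dual_bounded_mult[OF \<rho> this]
  have "dual_bounded n (1 / (1 + c) * (1 / (1 - r))) (\<lambda>s. \<rho> s * (1 / (1 - \<rho> s * \<sigma> s)))" .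
  moreover have "1 / (1 + c) * (1 / (1 - r)) = 1"
    using c by (simp add: r_def field_simps)
  moreover have "\<rho> s * (1 / (1 - \<rho> s * \<sigma> s)) = 1 / (1 + 2 * (\<Sum>i<n. real (s i) / (1 + L i * real (s i))))" for s
  proof -
    have "(\<Sum>i<n. real (s i) / (1 + L i * real (s i)))
        = real (s 0) + (\<Sum>i\<in>{1..<n}. real (s i) / (1 + L i * real (s i)))"
      using n L0 by (simp add: lessThan_atLeast0 sum.atLeast_Suc_lessThan)
    moreover have "2 * (\<Sum>i\<in>{1..<n}. real (s i) / (1 + L i * real (s i))) = c - \<sigma> s"
      unfolding c_def \<sigma>_def sum_distrib_left sum_subtractf[symmetric]
    proof (rule sum.cong)
      fix i assume "i \<in> {1..<n}"
      then have "0 < L i" using L by simp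
      moreover from this have "0 < 1 + L i * real (s i)" by (simp add: add_pos_nonneg)
      ultimately have "real (s i) / (1 + L i * real (s i)) = 1 / L i * (1 - 1 / (1 + L i * real (s i)))"
        by (simp add: diff_divide_eq_iff)
      then show "2 * (real (s i) / (1 + L i * real (s i))) = 2 / L i - 2 / L i * (1 / (1 + L i * real (s i)))"
        by (simp add: right_diff_distrib)
    qed simp
    moreover have "\<rho> s = 1 / (1 + c + 2 * real (s 0))"
    proof -
      have "(1 + c) * (1 + 2 / (1 + c) * real (s 0)) = 1 + c + 2 * real (s 0)"
        using c by (simp add: field_simps)
      then show ?thesis unfolding \<rho>_def by simp
    qed
    moreover have "0 < 1 + c + 2 * real (s 0)" using c by (simp add: add_pos_nonneg)
    ultimately have q: "0 < 1 + c + 2 * real (s 0)" "\<rho> s = 1 / (1 + c + 2 * real (s 0))"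
        "1 + 2 * (\<Sum>i<n. real (s i) / (1 + L i * real (s i))) = 1 + c + 2 * real (s 0) - \<sigma> s"
      by simp_all
    define q where "q = 1 + c + 2 * real (s 0)"
    have "1 - 1 / q * \<sigma> s = (q - \<sigma> s) / q"
      using q(1) by (simp add: q_def diff_divide_distrib)
    then show ?thesis
      unfolding q(2,3) q_def[symmetric] using q(1) by (simp add: q_def[symmetric])
  qed
  ultimately show ?thesis by simp
qed

text \<open>Put \<open>u = 1 - F\<close>, \<open>v = 1 - G\<close>, and let \<open>A\<close> be the
  sum of the \<open>a s i\<close>. On expanding the rank-two bracket, the products of
  \<open>A\<close> with the sums of \<open>a * u\<close> and \<open>a * v\<close> cancel, and
  \<open>D + (1 + A) * R - P - Q - P * Q\<close> remains, where \<open>D = 1 + 2 * A\<close>. This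
  matters because \<open>A\<close> is unbounded in \<open>s\<close>, whereas
  \<open>(1 + A) / D = (1 + 1 / D) / 2\<close> is a bounded functional.\<close>

lemma dual_bounded_permanental_diff:
  fixes L F G :: "nat \<Rightarrow> real" and \<phi> \<psi> :: "(nat \<Rightarrow> nat) \<Rightarrow> real"
  assumes L0: "L 0 = 0" and L: "\<And>i. 0 < i \<Longrightarrow> 0 < L i"
    and F0: "F 0 = 1" and F: "\<And>i. 0 \<le> F i \<and> F i \<le> 1"
    and G0: "G 0 = 1" and G: "\<And>i. 0 \<le> G i \<and> G i \<le> 1"
    and Fsum: "(\<Sum>i<n. (1 - F i) / L i) \<le> \<delta>" and Gsum: "(\<Sum>i<n. (1 - G i) / L i) \<le> \<delta>"
    and \<delta>: "\<delta> < 1 / 10" and n: "0 < n"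
  defines "a \<equiv> \<lambda>s i. real (s i) / (1 + L i * real (s i))"
  assumes \<phi>: "\<And>s. \<phi> s = 1 / ((\<Prod>i<n. 1 + L i * real (s i)) * ((1 + (\<Sum>i<n. a s i)) * (1 + (\<Sum>i<n. a s i * F i * G i))
      - (\<Sum>i<n. a s i * F i) * (\<Sum>i<n. a s i * G i))) powr \<alpha>"
    and \<psi>: "\<And>s. \<psi> s = 1 / ((\<Prod>i<n. 1 + L i * real (s i)) * (1 + 2 * (\<Sum>i<n. a s i))) powr \<alpha>"
    and bd: "dual_bounded n 1 \<psi>"
    and \<alpha>: "0 < \<alpha>"
  shows "dual_bounded n ((1 - 10 * \<delta>) powr (- \<alpha>) - 1) (\<lambda>s. \<phi> s - \<psi> s)"
proof -
  define u where "u i = 1 - F i" for i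
  define v where "v i = 1 - G i" for i
  have u: "u 0 = 0" "0 \<le> u i" "u i \<le> 1" for i using F0 F[of i] by (auto simp: u_def)
  have v: "v 0 = 0" "0 \<le> v i" "v i \<le> 1" for i using G0 G[of i] by (auto simp: v_def)
  have Lnn: "0 \<le> L i" for i using L0 L[of i] by (cases i) (auto intro: less_imp_le)
  have \<delta>0: "0 \<le> \<delta>"
    using order_trans[OF sum_nonneg Fsum] u Lnn by (simp add: u_def)
  \<comment> \<open>For \<open>i > 0\<close>, \<open>a s i\<close> is \<open>1 / L i\<close> times a
    difference of two functionals of norm one, hence the factor 2. At \<open>i = 0\<close> the
    weight \<open>w 0 = 0\<close> removes the unbounded term \<open>s 0\<close>.\<close>
  have dP: "dual_bounded n (2 * \<delta>) (\<lambda>s. \<Sum>i<n. a s i * w i)"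
    if w: "w 0 = 0" "\<And>i. 0 \<le> w i" "(\<Sum>i<n. w i / L i) \<le> \<delta>" for w
  proof -
    have eq: "a s i * w i = w i / L i * (1 - 1 / (1 + L i * real (s i)))" for s i
    proof (cases "i = 0")
      case False
      then have "0 < L i" using L by simp
      moreover from this have "0 < 1 + L i * real (s i)" by (simp add: add_pos_nonneg)
      ultimately show ?thesis by (simp add: a_def field_simps)
    qed (use w in simp)
    have "dual_bounded n (\<Sum>i<n. \<bar>w i / L i\<bar> * (\<bar>1\<bar> + 1)) (\<lambda>s. \<Sum>i<n. a s i * w i)"
      unfolding eq
      by (intro dual_bounded_sum dual_bounded_scale dual_bounded_diff dual_bounded_const dual_bounded_exponential Lnn) simp
    moreover have "(\<Sum>i<n. \<bar>w i / L i\<bar> * (\<bar>1\<bar> + 1)) = 2 * (\<Sum>i<n. w i / L i)"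
      unfolding sum_distrib_left by (intro sum.cong) (use w Lnn in auto)
    ultimately show ?thesis using dual_bounded_mono w(3) by simp
  qed
  define P where "P s = (\<Sum>i<n. a s i * u i)" for s
  define Q where "Q s = (\<Sum>i<n. a s i * v i)" for s
  define R where "R s = (\<Sum>i<n. a s i * (u i * v i))" for s
  define D where "D s = 1 + 2 * (\<Sum>i<n. a s i)" for s
  have P: "dual_bounded n (2 * \<delta>) P" unfolding P_def
    by (rule dP) (use u Fsum in \<open>auto simp: u_def\<close>)
  have Q: "dual_bounded n (2 * \<delta>) Q" unfolding Q_def
    by (rule dP) (use v Gsum in \<open>auto simp: v_def\<close>)
  have R: "dual_bounded n (2 * \<delta>) R" unfolding R_def
  proof (rule dP)
    have "(\<Sum>i<n. u i * v i / L i) \<le> (\<Sum>i<n. u i / L i)"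
      by (intro sum_mono divide_right_mono Lnn) (use u v in \<open>simp add: mult_left_le\<close>)
    then show "(\<Sum>i<n. u i * v i / L i) \<le> \<delta>" using Fsum by (simp add: u_def)
  qed (use u v in auto)
  have D: "dual_bounded n 1 (\<lambda>s. 1 / D s)"
    unfolding D_def a_def by (rule dual_bounded_inverse_affine) (use L0 L n in auto)
  \<comment> \<open>\<open>W\<close> is chosen so that the rank-two bracket in \<open>\<phi>\<close> equals \<open>D * (1 + W)\<close>.\<close>
  define W where "W s = 1 / 2 * R s + (1 / 2 * R s - P s - Q s - P s * Q s) * (1 / D s)" for s
  have "dual_bounded n (\<bar>1 / 2\<bar> * (2 * \<delta>) + (\<bar>1 / 2\<bar> * (2 * \<delta>) + 2 * \<delta> + 2 * \<delta> + 2 * \<delta> * (2 * \<delta>)) * 1) W"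
    unfolding W_def
    by (intro dual_bounded_add dual_bounded_mult dual_bounded_scale dual_bounded_diff P Q R D)
  \<comment> \<open>The bound on the norm is \<open>6 * \<delta> + 4 * \<delta> * \<delta>\<close>,
    which is at most \<open>10 * \<delta>\<close> because \<open>\<delta>\<close> is below
    1.\<close>
  then have W: "dual_bounded n (10 * \<delta>) W"
  proof (rule dual_bounded_mono)
    have "\<delta> * \<delta> \<le> \<delta> * 1" using \<delta> \<delta>0 by (intro mult_left_mono) auto
    then show "\<bar>1 / 2\<bar> * (2 * \<delta>) + (\<bar>1 / 2\<bar> * (2 * \<delta>) + 2 * \<delta> + 2 * \<delta> + 2 * \<delta> * (2 * \<delta>)) * 1 \<le> 10 * \<delta>"
      by simp
  qed
  have absW: "\<bar>W s\<bar> < 1" for s using dual_bounded_abs_le[OF W, of s] \<delta> by simp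
  \<comment> \<open>The binomial series of \<open>(1 + x) powr (- \<alpha>)\<close> without its
    constant term. Its coefficients have sign \<open>(- 1) ^ j\<close>, so their absolute values
    give the series at \<open>- x\<close>; this is why the norm bound has the closed form
    \<open>(1 - 10 * \<delta>) powr (- \<alpha>) - 1\<close>.\<close>
  define b where "b j = (if j = 0 then 0 else (- \<alpha>) gchoose j)" for j :: nat
  have ser: "dual_bounded n ((1 - 10 * \<delta>) powr (- \<alpha>) - 1) (\<lambda>s. (1 + W s) powr (- \<alpha>) - 1)"
  proof (rule dual_bounded_power_series[OF W, of b])
    have shift: "(\<lambda>j. if j = 0 then 0 else h j) sums (S - h 0)" if "h sums S" for h :: "nat \<Rightarrow> real" and S
    proof -
      have "(\<lambda>j. h j - (if j = 0 then h 0 else 0)) sums (S - h 0)"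
        by (intro sums_diff that sums_If_finite_set[of "{0}", simplified]) 
      moreover have "(\<lambda>j. h j - (if j = 0 then h 0 else 0)) = (\<lambda>j. if j = 0 then 0 else h j)" by auto
      ultimately show ?thesis by simp
    qed
    have "(\<lambda>j. ((- \<alpha>) gchoose j) * (- (10 * \<delta>)) ^ j) sums (1 + - (10 * \<delta>)) powr (- \<alpha>)"
      by (rule gen_binomial_real) (use \<delta> \<delta>0 in simp)
    moreover have "((- \<alpha>) gchoose j) * (- (10 * \<delta>)) ^ j = \<bar>(- \<alpha>) gchoose j\<bar> * (10 * \<delta>) ^ j" for j
    proof -
      have 1: "((- \<alpha>) gchoose j) = (- 1) ^ j * (pochhammer \<alpha> j / fact j)"
        by (simp add: gbinomial_pochhammer)
      have 2: "0 \<le> pochhammer \<alpha> j / fact j" using \<alpha> by (simp add: pochhammer_nonneg)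
      define q where "q = pochhammer \<alpha> j / fact j"
      have sq: "(- 1) ^ j * (- 1) ^ j = (1 :: real)" by (simp flip: power_mult_distrib)
      have "\<bar>(- \<alpha>) gchoose j\<bar> = q"
        using 2 unfolding 1 q_def[symmetric] by (simp add: abs_mult)
      moreover have "((- \<alpha>) gchoose j) * (- (10 * \<delta>)) ^ j = ((- 1) ^ j * (- 1) ^ j) * q * (10 * \<delta>) ^ j"
        unfolding 1 q_def[symmetric] power_minus[of "10 * \<delta>"] by (simp only: ac_simps)
      ultimately show ?thesis unfolding sq by simp
    qed
    ultimately have "(\<lambda>j. \<bar>(- \<alpha>) gchoose j\<bar> * (10 * \<delta>) ^ j) sums (1 - 10 * \<delta>) powr (- \<alpha>)" by simp
    from shift[OF this] show "(\<lambda>j. \<bar>b j\<bar> * (10 * \<delta>) ^ j) sums ((1 - 10 * \<delta>) powr (- \<alpha>) - 1)"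
      by (simp add: b_def if_distrib if_distribR cong: if_cong)
    from shift[OF gen_binomial_real[OF absW, of "- \<alpha>"]]
    show "(\<lambda>j. b j * W s ^ j) sums ((1 + W s) powr (- \<alpha>) - 1)" for s
      by (simp add: b_def if_distrib if_distribR cong: if_cong)
  qed
  have eq: "\<phi> s - \<psi> s = \<psi> s * ((1 + W s) powr (- \<alpha>) - 1)" for s
  proof -
    let ?A = "\<Sum>i<n. a s i"
    have a0: "0 \<le> a s i" for i using Lnn[of i] by (auto simp: a_def)
    then have D1: "1 \<le> D s" unfolding D_def by (simp add: sum_nonneg)
    have pr: "0 < (\<Prod>i<n. 1 + L i * real (s i))"
      by (intro prod_pos) (use Lnn in \<open>auto simp: add_pos_nonneg\<close>)
    have "(\<Sum>i<n. a s i * F i) = ?A - P s" "(\<Sum>i<n. a s i * G i) = ?A - Q s"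
      "(\<Sum>i<n. a s i * F i * G i) = ?A - P s - Q s + R s"
      unfolding P_def Q_def R_def sum_subtractf[symmetric] sum.distrib[symmetric]
      by (auto intro!: sum.cong simp: u_def v_def algebra_simps)
    then have "(1 + ?A) * (1 + (\<Sum>i<n. a s i * F i * G i)) - (\<Sum>i<n. a s i * F i) * (\<Sum>i<n. a s i * G i)
        = (1 + ?A) * (1 + (?A - P s - Q s + R s)) - (?A - P s) * (?A - Q s)" by simp
    also have "\<dots> = D s * (1 + W s)"
    proof -
      have "D s * W s = D s * R s / 2 + (R s / 2 - P s - Q s - P s * Q s)"
        using D1 by (simp add: W_def field_simps)
      then show ?thesis by (simp add: distrib_left) (simp add: D_def field_simps)
    qed
    finally have "\<phi> s = 1 / ((\<Prod>i<n. 1 + L i * real (s i)) * D s * (1 + W s)) powr \<alpha>"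
      unfolding \<phi> by (simp add: mult.assoc)
    also have "\<dots> = 1 / ((\<Prod>i<n. 1 + L i * real (s i)) * D s) powr \<alpha> * (1 + W s) powr (- \<alpha>)"
      using pr D1 absW[of s] by (subst powr_mult) (auto simp: powr_minus divide_inverse)
    finally have "\<phi> s = \<psi> s * (1 + W s) powr (- \<alpha>)"
      unfolding \<psi> D_def .
    then show ?thesis by (simp add: right_diff_distrib)
  qed
  show ?thesis unfolding eq using dual_bounded_mult[OF bd ser] by simp
qed

section \<open>Total variation bounds from Laplace functionals\<close>

definition poly_val :: "nat \<Rightarrow> (real \<times> (nat \<Rightarrow> nat)) list \<Rightarrow> (nat \<Rightarrow> real) \<Rightarrow> real" where
  "poly_val n ps y = (\<Sum>(c, s)\<leftarrow>ps. c * monom_val n s y)"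

lemma compact_unit_cube: "compact unit_cube"
proof -
  have "unit_cube = Pi\<^sub>E UNIV (\<lambda>_. {0..1::real})"
    by (auto simp: unit_cube_def PiE_UNIV_domain)
  moreover have "compactin (product_topology (\<lambda>_::nat. euclidean) UNIV) (Pi\<^sub>E UNIV (\<lambda>_. {0..1::real}))"
    by (simp add: compactin_PiE)
  ultimately show ?thesis by (simp add: euclidean_product_topology)
qed

lemma continuous_on_poly_val: "continuous_on S (poly_val n ps)"
proof -
  have "continuous_on S (monom_val n s)" for s
    unfolding monom_val_def[abs_def]
    by (intro continuous_intros continuous_on_subset[OF continuous_on_product_coordinates] subset_UNIV)
  then show ?thesis
    by (induction ps) (auto simp: poly_val_def[abs_def] intro!: continuous_intros)
qed

lemma poly_val_append: "poly_val n (ps @ qs) y = poly_val n ps y + poly_val n qs y"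
  by (simp add: poly_val_def)

lemma poly_val_mult:
  "poly_val n (concat (map (\<lambda>(c, s). map (\<lambda>(d, t). (c * d, \<lambda>i. s i + t i)) qs) ps)) y
    = poly_val n ps y * poly_val n qs y"
proof (induction ps)
  case (Cons p ps)
  have "poly_val n (map (\<lambda>(d, t). (fst p * d, \<lambda>i. snd p i + t i)) qs) y
      = fst p * monom_val n (snd p) y * poly_val n qs y"
    by (induction qs) (auto simp: poly_val_def monom_val_add algebra_simps)
  with Cons show ?case
    by (cases p) (simp add: poly_val_append, simp add: poly_val_def algebra_simps)
qed (simp add: poly_val_def)

text \<open>Two polynomials can be added or multiplied only over the same number of variables.
  Exponents beyond \<open>n\<close> are set to 0 because \<open>monom_val N\<close> would read
  them.\<close>

lemma poly_val_pad:
  assumes "n \<le> N"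
  shows "poly_val N (map (\<lambda>(c, s). (c, \<lambda>i. if i < n then s i else 0)) ps) y = poly_val n ps y"
proof -
  have "monom_val N (\<lambda>i. if i < n then s i else 0) y = monom_val n s y" for s
    unfolding monom_val_def using assms
    by (intro prod.mono_neutral_cong_right) auto
  then show ?thesis by (induction ps) (auto simp: poly_val_def)
qed

text \<open>Stone-Weierstrass on the infinite-dimensional cube: polynomials in finitely many
  variables form an algebra with constants, and the coordinates separate points.\<close>

lemma poly_val_dense:
  assumes "continuous_on unit_cube h" "0 < e"
  obtains n ps where "\<And>y. y \<in> unit_cube \<Longrightarrow> \<bar>h y - poly_val n ps y\<bar> < e"
proof -
  define P where "P h \<longleftrightarrow> (\<exists>n ps. h = poly_val n ps)" for h
  have common: "\<exists>N ps qs. h = poly_val N ps \<and> k = poly_val N qs" if hk: "P h" "P k" for h k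
  proof -
    obtain n ps where h: "h = poly_val n ps" using hk(1) unfolding P_def by blast
    obtain m qs where k: "k = poly_val m qs" using hk(2) unfolding P_def by blast
    show ?thesis
      unfolding h k
      by (intro exI conjI ext)
        (rule poly_val_pad[of n "max n m" ps, symmetric, OF max.cobounded1],
         rule poly_val_pad[of m "max n m" qs, symmetric, OF max.cobounded2])
  qed
  have "\<exists>g. P g \<and> (\<forall>x\<in>unit_cube. \<bar>h x - g x\<bar> < e)"
  proof (rule Stone_Weierstrass_HOL[where P = P])
    show "P (\<lambda>x. c)" for c
      unfolding P_def by (rule exI[of _ 0], rule exI[of _ "[(c, \<lambda>_. 0)]"])
        (simp add: poly_val_def monom_val_def fun_eq_iff)
    show "P f \<Longrightarrow> continuous_on unit_cube f" for f
      unfolding P_def using continuous_on_poly_val by auto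
    show "P (\<lambda>x. f x + g x)" if "P f \<and> P g" for f g
    proof -
      obtain N ps qs where "f = poly_val N ps" "g = poly_val N qs" using common \<open>P f \<and> P g\<close> by blast
      then have "(\<lambda>x. f x + g x) = poly_val N (ps @ qs)" by (auto simp: poly_val_append)
      then show ?thesis unfolding P_def by blast
    qed
    show "P (\<lambda>x. f x * g x)" if "P f \<and> P g" for f g
    proof -
      obtain N ps qs where "f = poly_val N ps" "g = poly_val N qs" using common \<open>P f \<and> P g\<close> by blast
      then have "(\<lambda>x. f x * g x)
          = poly_val N (concat (map (\<lambda>(c, s). map (\<lambda>(d, t). (c * d, \<lambda>i. s i + t i)) qs) ps))"
        by (auto simp: poly_val_mult)
      then show ?thesis unfolding P_def by blast
    qed
    show "\<exists>f. P f \<and> f x \<noteq> f y" if "x \<in> unit_cube \<and> y \<in> unit_cube \<and> x \<noteq> y" for x y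
    proof -
      have "\<exists>i. x i \<noteq> y i" using that by (auto simp: fun_eq_iff)
      then obtain i where i: "x i \<noteq> y i" by blast
      define f where "f = poly_val (Suc i) [(1, \<lambda>j. if j = i then 1 else 0)]"
      have "f z = z i" for z
      proof -
        have "f z = (\<Prod>j<Suc i. z j ^ (if j = i then 1 else 0))"
          by (simp add: f_def poly_val_def monom_val_def del: prod.lessThan_Suc)
        also have "\<dots> = (\<Prod>j<Suc i. if j = i then z j else 1)"
          by (rule prod.cong) auto
        finally show ?thesis by (simp del: prod.lessThan_Suc)
      qed
      moreover have "P f" unfolding P_def f_def by blast
      ultimately show ?thesis using i by metis
    qed
  qed (use compact_unit_cube assms in auto)
  then show thesis using that unfolding P_def by blast
qed

section \<open>From functionals to probabilities of events\<close>

lemma (in prob_space) abs_expectation_diff_le: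
  fixes h k :: "_ \<Rightarrow> real"
  assumes "integrable M h" "integrable M k" "\<And>\<omega>. \<omega> \<in> space M \<Longrightarrow> \<bar>h \<omega> - k \<omega>\<bar> \<le> d"
  shows "\<bar>expectation h - expectation k\<bar> \<le> d"
proof -
  have "\<bar>expectation (\<lambda>\<omega>. h \<omega> - k \<omega>)\<bar> \<le> expectation (\<lambda>\<omega>. \<bar>h \<omega> - k \<omega>\<bar>)"
    by (rule integral_abs_bound)
  also have "\<dots> \<le> expectation (\<lambda>_. d)"
    by (rule integral_mono) (use assms in auto)
  finally show ?thesis using assms by (simp add: prob_space)
qed

text \<open>The bound passes from polynomials to continuous functions with values in [-1, 1] by
  density, to closed sets by dominated convergence, and to Borel sets by inner regularity. As
  \<open>\<epsilon>\<close> is the same for every \<open>n\<close>, events that depend on all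
  coordinates are covered.\<close>

lemma measure_le_of_dual_bounded:
  fixes Y :: "nat \<Rightarrow> 'a \<Rightarrow> real" and Z :: "nat \<Rightarrow> 'b \<Rightarrow> real"
  assumes M: "prob_space M" and N: "prob_space N"
    and Y: "\<And>i. Y i \<in> borel_measurable M" "\<And>i \<omega>. \<omega> \<in> space M \<Longrightarrow> 0 \<le> Y i \<omega>"
    and Z: "\<And>i. Z i \<in> borel_measurable N" "\<And>i \<omega>. \<omega> \<in> space N \<Longrightarrow> 0 \<le> Z i \<omega>"
    and db: "\<And>n. dual_bounded n \<epsilon> (\<lambda>s. (\<integral>\<omega>. monom_val n s (\<lambda>i. exp (- Y i \<omega>)) \<partial>M)
      - (\<integral>\<omega>. monom_val n s (\<lambda>i. exp (- Z i \<omega>)) \<partial>N))"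
    and E: "E \<in> sets (Pi\<^sub>M UNIV (\<lambda>_::nat. borel))"
  shows "measure N {\<omega> \<in> space N. (\<lambda>i. Z i \<omega>) \<in> E} \<le> measure M {\<omega> \<in> space M. (\<lambda>i. Y i \<omega>) \<in> E} + \<epsilon>"
proof -
  interpret M: prob_space M by fact
  interpret N: prob_space N by fact
  note [measurable] = Y(1) Z(1)
  define y where "y = (\<lambda>\<omega> i. exp (- Y i \<omega>))"
  define z where "z = (\<lambda>\<omega> i. exp (- Z i \<omega>))"
  have [measurable]: "y \<in> borel_measurable M" "z \<in> borel_measurable N"
    unfolding y_def z_def
    by (auto intro!: measurable_coordinatewise_then_product)
  have cube: "\<omega> \<in> space M \<Longrightarrow> y \<omega> \<in> unit_cube" "\<omega>' \<in> space N \<Longrightarrow> z \<omega>' \<in> unit_cube" for \<omega> \<omega>'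
    using Y Z by (auto simp: y_def z_def unit_cube_def)
  have eps: "0 \<le> \<epsilon>" using db dual_bounded_nonneg by blast
  have poly: "\<bar>(\<integral>\<omega>. poly_val n ps (y \<omega>) \<partial>M) - (\<integral>\<omega>. poly_val n ps (z \<omega>) \<partial>N)\<bar> \<le> \<epsilon> * B"
    and polyint: "integrable M (\<lambda>\<omega>. poly_val n ps (y \<omega>))" "integrable N (\<lambda>\<omega>. poly_val n ps (z \<omega>))"
    if "\<And>x. x \<in> unit_cube \<Longrightarrow> \<bar>poly_val n ps x\<bar> \<le> B" for n ps B
  proof -
    note iM = M.integral_poly[of n y, unfolded y_def, OF M.integrable_monom_val_exp[of n Y, OF Y]]
    note iN = N.integral_poly[of n z, unfolded z_def, OF N.integrable_monom_val_exp[of n Z, OF Z]]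
    have "\<bar>\<Sum>(c, s)\<leftarrow>ps. c * ((\<integral>\<omega>. monom_val n s (\<lambda>i. exp (- Y i \<omega>)) \<partial>M)
      - (\<integral>\<omega>. monom_val n s (\<lambda>i. exp (- Z i \<omega>)) \<partial>N))\<bar> \<le> \<epsilon> * B"
      by (rule dual_boundedD[OF db]) (use that in \<open>auto simp: poly_val_def\<close>)
    moreover have "(\<Sum>(c, s)\<leftarrow>ps. c * (f s - g s)) = (\<Sum>(c, s)\<leftarrow>ps. c * f s) - (\<Sum>(c, s)\<leftarrow>ps. c * g s)"
      for f g :: "(nat \<Rightarrow> nat) \<Rightarrow> real"
      by (induction ps) (auto simp: algebra_simps)
    ultimately show "\<bar>(\<integral>\<omega>. poly_val n ps (y \<omega>) \<partial>M) - (\<integral>\<omega>. poly_val n ps (z \<omega>) \<partial>N)\<bar> \<le> \<epsilon> * B"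
      using iM(2)[of ps] iN(2)[of ps] by (simp add: poly_val_def y_def z_def)
    show "integrable M (\<lambda>\<omega>. poly_val n ps (y \<omega>))" "integrable N (\<lambda>\<omega>. poly_val n ps (z \<omega>))"
      using iM(1)[of ps] iN(1)[of ps] by (simp_all add: poly_val_def y_def z_def)
  qed
  have cont: "\<bar>(\<integral>\<omega>. h (y \<omega>) \<partial>M) - (\<integral>\<omega>. h (z \<omega>) \<partial>N)\<bar> \<le> \<epsilon>"
    and contint: "integrable M (\<lambda>\<omega>. h (y \<omega>))" "integrable N (\<lambda>\<omega>. h (z \<omega>))"
    if h: "continuous_on UNIV h" "\<And>x. \<bar>h x\<bar> \<le> 1" for h :: "(nat \<Rightarrow> real) \<Rightarrow> real"
  proof -
    have [measurable]: "h \<in> borel_measurable borel" by (rule borel_measurable_continuous_onI[OF h(1)])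
    show int: "integrable M (\<lambda>\<omega>. h (y \<omega>))" "integrable N (\<lambda>\<omega>. h (z \<omega>))"
      using h(2) by (auto intro!: M.integrable_const_bound[where B = 1] N.integrable_const_bound[where B = 1])
    \<comment> \<open>Approximation costs \<open>d\<close> in each integral and raises the bound on
      the polynomial to \<open>1 + d\<close>, in all
      \<open>\<epsilon> * (1 + d) + 2 * d\<close>.\<close>
    have le: "\<bar>(\<integral>\<omega>. h (y \<omega>) \<partial>M) - (\<integral>\<omega>. h (z \<omega>) \<partial>N)\<bar> \<le> \<epsilon> + (2 + \<epsilon>) * d" if "0 < d" for d
    proof -
      obtain n ps where p: "\<And>x. x \<in> unit_cube \<Longrightarrow> \<bar>h x - poly_val n ps x\<bar> < d"
        using poly_val_dense[OF continuous_on_subset[OF h(1)] \<open>0 < d\<close>] by auto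
      have b: "\<bar>poly_val n ps x\<bar> \<le> 1 + d" if "x \<in> unit_cube" for x
        using p[OF that] h(2)[of x] by linarith
      have "\<bar>(\<integral>\<omega>. h (y \<omega>) \<partial>M) - (\<integral>\<omega>. poly_val n ps (y \<omega>) \<partial>M)\<bar> \<le> d"
        using p cube by (intro M.abs_expectation_diff_le int polyint[OF b]) (auto intro: less_imp_le)
      moreover have "\<bar>(\<integral>\<omega>. h (z \<omega>) \<partial>N) - (\<integral>\<omega>. poly_val n ps (z \<omega>) \<partial>N)\<bar> \<le> d"
        using p cube by (intro N.abs_expectation_diff_le int polyint[OF b]) (auto intro: less_imp_le)
      ultimately show ?thesis using poly[OF b] by (simp add: algebra_simps)
    qed
    show "\<bar>(\<integral>\<omega>. h (y \<omega>) \<partial>M) - (\<integral>\<omega>. h (z \<omega>) \<partial>N)\<bar> \<le> \<epsilon>"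
    proof (rule field_le_epsilon)
      fix e :: real assume "0 < e"
      then show "\<bar>(\<integral>\<omega>. h (y \<omega>) \<partial>M) - (\<integral>\<omega>. h (z \<omega>) \<partial>N)\<bar> \<le> \<epsilon> + e"
        using le[of "e / (2 + \<epsilon>)"] eps by simp
    qed
  qed
  have closed: "measure N {\<omega> \<in> space N. z \<omega> \<in> F} \<le> measure M {\<omega> \<in> space M. y \<omega> \<in> F} + \<epsilon>"
    if F: "closed F" for F
  proof (cases "F = {}")
    case True
    then show ?thesis using eps by simp
  next
    case False
    \<comment> \<open>These continuous functions decrease to the indicator of the closed set
      \<open>F\<close>.\<close>
    define h where "h k x = max 0 (1 - real k * infdist x F)" for k :: nat and x
    have h: "continuous_on UNIV (h k)" "\<bar>h k x\<bar> \<le> 1" for k x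
      unfolding h_def by (intro continuous_intros) (auto simp: infdist_nonneg)
    have lim: "(\<lambda>k. h k x) \<longlonglongrightarrow> indicat_real F x" for x
    proof (cases "x \<in> F")
      case False
      then have d: "0 < infdist x F" using F \<open>F \<noteq> {}\<close> infdist_pos_not_in_closed by blast
      then obtain K :: nat where K: "1 < real K * infdist x F" using reals_Archimedean3 by blast
      have "h k x = 0" if "K \<le> k" for k
      proof -
        have "real K * infdist x F \<le> real k * infdist x F" using that d by (simp add: mult_right_mono)
        then show ?thesis using K by (simp add: h_def)
      qed
      then show ?thesis using False
        by (auto intro!: tendsto_eventually eventually_sequentiallyI[of K])
    qed (simp add: h_def)
    have [measurable]: "F \<in> sets borel" using F by simp
    have [measurable]: "h k \<in> borel_measurable borel" for k
      by (rule borel_measurable_continuous_onI[OF h(1)])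
    have "(\<lambda>k. \<integral>\<omega>. h k (y \<omega>) \<partial>M) \<longlonglongrightarrow> (\<integral>\<omega>. indicat_real F (y \<omega>) \<partial>M)"
      by (rule integral_dominated_convergence[where w = "\<lambda>_. 1"]) (use h lim in auto)
    moreover have "(\<lambda>k. \<integral>\<omega>. h k (z \<omega>) \<partial>N) \<longlonglongrightarrow> (\<integral>\<omega>. indicat_real F (z \<omega>) \<partial>N)"
      by (rule integral_dominated_convergence[where w = "\<lambda>_. 1"]) (use h lim in auto)
    moreover have "(\<integral>\<omega>. indicat_real F (y \<omega>) \<partial>M) = measure M {\<omega> \<in> space M. y \<omega> \<in> F}"
    proof -
      have "(\<integral>\<omega>. indicat_real F (y \<omega>) \<partial>M) = (\<integral>\<omega>. indicat_real {\<omega> \<in> space M. y \<omega> \<in> F} \<omega> \<partial>M)"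
        by (rule Bochner_Integration.integral_cong) (auto simp: indicator_def)
      then show ?thesis by (simp add: Int_absorb1)
    qed
    moreover have "(\<integral>\<omega>. indicat_real F (z \<omega>) \<partial>N) = measure N {\<omega> \<in> space N. z \<omega> \<in> F}"
    proof -
      have "(\<integral>\<omega>. indicat_real F (z \<omega>) \<partial>N) = (\<integral>\<omega>. indicat_real {\<omega> \<in> space N. z \<omega> \<in> F} \<omega> \<partial>N)"
        by (rule Bochner_Integration.integral_cong) (auto simp: indicator_def)
      then show ?thesis by (simp add: Int_absorb1)
    qed
    ultimately have "(\<lambda>k. \<integral>\<omega>. h k (y \<omega>) \<partial>M) \<longlonglongrightarrow> measure M {\<omega> \<in> space M. y \<omega> \<in> F}"
      "(\<lambda>k. \<integral>\<omega>. h k (z \<omega>) \<partial>N) \<longlonglongrightarrow> measure N {\<omega> \<in> space N. z \<omega> \<in> F}" by simp_all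
    then show ?thesis
      by (intro LIMSEQ_le[of "\<lambda>k. \<integral>\<omega>. h k (z \<omega>) \<partial>N" _ "\<lambda>k. (\<integral>\<omega>. h k (y \<omega>) \<partial>M) + \<epsilon>"] tendsto_intros)
        (use cont[OF h] in \<open>auto simp: abs_le_iff algebra_simps\<close>)
  qed
  \<comment> \<open>The event is moved to the coordinates \<open>exp (- Y i)\<close> in which the
    functionals live. The values of \<open>y\<close> and \<open>z\<close> have positive coordinates,
    so \<open>ln\<close> inverts the exponential there.\<close>
  define E' where "E' = (\<lambda>u i. - ln (u i :: real)) -` E"
  have "(\<lambda>(u :: nat \<Rightarrow> real) i. - ln (u i)) \<in> borel_measurable borel"
    by (rule measurable_coordinatewise_then_product) (auto intro!: measurable_product_coordinates)
  moreover have "E \<in> sets borel" using E by (simp add: sets_PiM_equal_borel)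
  ultimately have [measurable]: "E' \<in> sets borel"
    unfolding E'_def using measurable_sets[of _ borel borel E] by simp
  have eq: "{\<omega> \<in> space N. (\<lambda>i. Z i \<omega>) \<in> E} = {\<omega> \<in> space N. z \<omega> \<in> E'}"
     "{\<omega> \<in> space M. (\<lambda>i. Y i \<omega>) \<in> E} = {\<omega> \<in> space M. y \<omega> \<in> E'}"
    by (auto simp: E'_def y_def z_def)
  interpret D: prob_space "distr N borel z" by (rule N.prob_space_distr) simp
  have dm: "measure (distr N borel z) A = measure N {\<omega> \<in> space N. z \<omega> \<in> A}" if "A \<in> sets borel" for A
    using that by (subst measure_distr) (auto intro!: arg_cong[where f = "measure N"])
  have "measure N {\<omega> \<in> space N. z \<omega> \<in> E'} \<le> measure M {\<omega> \<in> space M. y \<omega> \<in> E'} + \<epsilon> + d"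
    if "0 < d" for d
  proof -
    \<comment> \<open>Approximation from inside fits the inequality: the bound for a compact
      \<open>K\<close> inside \<open>E'\<close> extends to \<open>E'\<close> on the side of
      \<open>M\<close> by monotonicity and on the side of \<open>N\<close> at the cost of
      \<open>d\<close>.\<close>
    have inner: "emeasure (distr N borel z) E' = (SUP K\<in>{K. K \<subseteq> E' \<and> compact K}. emeasure (distr N borel z) K)"
      by (rule inner_regular) (auto simp: D.emeasure_space_1)
    have "\<exists>K. K \<subseteq> E' \<and> compact K \<and> emeasure (distr N borel z) E' < emeasure (distr N borel z) K + ennreal d"
    proof (rule ccontr)
      assume "\<not> ?thesis"
      then have "emeasure (distr N borel z) K + ennreal d \<le> emeasure (distr N borel z) E'"
        if "K \<subseteq> E'" "compact K" for K using that by (auto simp: not_less)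
      then have le: "measure (distr N borel z) K \<le> measure (distr N borel z) E' - d"
        if "K \<subseteq> E'" "compact K" for K
        using that \<open>0 < d\<close>
        by (auto simp: D.emeasure_eq_measure simp flip: ennreal_plus) (smt (verit))
      have "emeasure (distr N borel z) E' \<le> ennreal (measure (distr N borel z) E' - d)"
        unfolding inner
        by (rule SUP_least) (use le in \<open>auto simp: D.emeasure_eq_measure intro!: ennreal_leI\<close>)
      moreover have "0 \<le> measure (distr N borel z) E' - d" using le[of "{}"] by simp
      ultimately show False using \<open>0 < d\<close> by (simp add: D.emeasure_eq_measure)
    qed
    then obtain K where K: "K \<subseteq> E'" "compact K"
      and less: "emeasure (distr N borel z) E' < emeasure (distr N borel z) K + ennreal d" by blast
    have cl: "closed K" using K(2) compact_imp_closed by blast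
    have "measure (distr N borel z) E' < measure (distr N borel z) K + d"
      using less \<open>0 < d\<close> by (simp add: D.emeasure_eq_measure ennreal_less_iff flip: ennreal_plus)
    then have "measure N {\<omega> \<in> space N. z \<omega> \<in> E'} \<le> measure N {\<omega> \<in> space N. z \<omega> \<in> K} + d"
      using cl by (simp add: dm)
    moreover have "measure N {\<omega> \<in> space N. z \<omega> \<in> K} \<le> measure M {\<omega> \<in> space M. y \<omega> \<in> K} + \<epsilon>"
      by (rule closed[OF cl])
    moreover have "measure M {\<omega> \<in> space M. y \<omega> \<in> K} \<le> measure M {\<omega> \<in> space M. y \<omega> \<in> E'}"
      by (rule M.finite_measure_mono) (use K in auto)
    ultimately show ?thesis by simp
  qed
  then have "measure N {\<omega> \<in> space N. z \<omega> \<in> E'} \<le> measure M {\<omega> \<in> space M. y \<omega> \<in> E'} + \<epsilon>"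
    by (rule field_le_epsilon)
  then show ?thesis unfolding eq .
qed

section \<open>Gaussian sequences\<close>

abbreviation std_gauss :: "real measure" where
  "std_gauss \<equiv> density lborel (\<lambda>x. ennreal (std_normal_density x))"

abbreviation gauss_vec :: "nat \<Rightarrow> (nat \<Rightarrow> real) measure" where
  "gauss_vec k \<equiv> Pi\<^sub>M {..<k} (\<lambda>_. std_gauss)"

abbreviation gauss_seq :: "nat \<Rightarrow> (nat \<Rightarrow> nat \<Rightarrow> real) measure" where
  "gauss_seq k \<equiv> Pi\<^sub>M UNIV (\<lambda>_. gauss_vec k)"

lemma prob_space_std_gauss: "prob_space std_gauss"
  by (rule prob_space_normal_density) simp

lemma prob_space_gauss_vec: "prob_space (gauss_vec k)"
  by (intro prob_space_PiM prob_space_std_gauss)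

lemma prob_space_gauss_seq: "prob_space (gauss_seq k)"
  by (intro prob_space_PiM prob_space_gauss_vec)

text \<open>Completing the square turns the integrand into a multiple of the normal density with
  mean \<open>- q / (1 + p)\<close> and variance \<open>1 / (1 + p)\<close>. Negative
  \<open>p\<close> above -1 is allowed, which yields the exponential moments for the tail
  bound.\<close>

lemma nn_integral_gauss_exp_quadratic:
  fixes p q r :: real
  assumes p: "0 < 1 + p"
  shows "(\<integral>\<^sup>+x. ennreal (exp (- (p * x\<^sup>2 + 2 * q * x + r) / 2)) \<partial>std_gauss)
    = ennreal (1 / sqrt (1 + p) * exp (- (r - q\<^sup>2 / (1 + p)) / 2))"
proof -
  define \<sigma> where "\<sigma> = 1 / sqrt (1 + p)"
  define \<mu> where "\<mu> = - q / (1 + p)"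
  have \<sigma>: "0 < \<sigma>" "\<sigma>\<^sup>2 = 1 / (1 + p)" using p by (auto simp: \<sigma>_def power_divide)
  let ?c = "\<sigma> * exp (- (r - q\<^sup>2 / (1 + p)) / 2)"
  have eq: "std_normal_density x * exp (- (p * x\<^sup>2 + 2 * q * x + r) / 2) = ?c * normal_density \<mu> \<sigma> x" for x
  proof -
    have "(x - \<mu>)\<^sup>2 / (2 * \<sigma>\<^sup>2) = (1 + p) * (x - \<mu>)\<^sup>2 / 2"
      by (simp add: \<sigma>(2))
    also have "\<dots> = ((1 + p) * x\<^sup>2 + 2 * q * x + q\<^sup>2 / (1 + p)) / 2"
    proof -
      define D where "D = 1 + p"
      have "D \<noteq> 0" using p by (simp add: D_def)
      then have "D * (x - - q / D)\<^sup>2 = D * x\<^sup>2 + 2 * q * x + q\<^sup>2 / D"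
        by (simp add: power2_eq_square field_simps)
      then show ?thesis by (simp add: \<mu>_def D_def)
    qed
    finally have "- x\<^sup>2 / 2 + - (p * x\<^sup>2 + 2 * q * x + r) / 2
        = - (r - q\<^sup>2 / (1 + p)) / 2 + - (x - \<mu>)\<^sup>2 / (2 * \<sigma>\<^sup>2)"
      by (simp add: field_simps)
    then have e: "exp (- x\<^sup>2 / 2) * exp (- (p * x\<^sup>2 + 2 * q * x + r) / 2)
        = exp (- (r - q\<^sup>2 / (1 + p)) / 2) * exp (- (x - \<mu>)\<^sup>2 / (2 * \<sigma>\<^sup>2))"
      by (simp only: exp_add[symmetric])
    have "sqrt (2 * pi * \<sigma>\<^sup>2) = sqrt (2 * pi) * \<sigma>" using \<sigma>(1) by (simp add: real_sqrt_mult)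
    then show ?thesis
      unfolding std_normal_density_def normal_density_def using \<sigma>(1) e by (simp add: mult.assoc)
  qed
  have "(\<integral>\<^sup>+x. ennreal (exp (- (p * x\<^sup>2 + 2 * q * x + r) / 2)) \<partial>std_gauss)
      = (\<integral>\<^sup>+x. ennreal (std_normal_density x * exp (- (p * x\<^sup>2 + 2 * q * x + r) / 2)) \<partial>lborel)"
    by (subst nn_integral_density) (auto simp: ennreal_mult')
  also have "\<dots> = (\<integral>\<^sup>+x. ennreal ?c * ennreal (normal_density \<mu> \<sigma> x) \<partial>lborel)"
    unfolding eq using \<sigma>(1) by (simp add: ennreal_mult')
  also have "\<dots> = ennreal ?c * (\<integral>\<^sup>+x. ennreal (normal_density \<mu> \<sigma> x) \<partial>lborel)"
    by (rule nn_integral_cmult) simp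
  also have "(\<integral>\<^sup>+x. ennreal (normal_density \<mu> \<sigma> x) \<partial>lborel) = 1"
    using \<sigma>(1) by (subst nn_integral_eq_integral) auto
  finally show ?thesis by (simp add: \<sigma>_def)
qed

lemma nn_integral_gauss_vec_prod:
  assumes "\<And>j. j < k \<Longrightarrow> f j \<in> borel_measurable borel"
  shows "(\<integral>\<^sup>+x. (\<Prod>j<k. f j (x j)) \<partial>gauss_vec k) = (\<Prod>j<k. \<integral>\<^sup>+x. f j x \<partial>std_gauss)"
proof -
  interpret P: product_sigma_finite "\<lambda>_::nat. std_gauss"
    by (simp add: product_sigma_finite_def prob_space_std_gauss prob_space_imp_sigma_finite)
  show ?thesis by (rule P.product_nn_integral_prod) (use assms in auto)
qed

lemma nn_integral_gauss_seq_prod: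
  assumes "finite J" "\<And>j. j \<in> J \<Longrightarrow> f j \<in> borel_measurable (gauss_vec k)"
  shows "(\<integral>\<^sup>+x. (\<Prod>j\<in>J. f j (x j)) \<partial>gauss_seq k) = (\<Prod>j\<in>J. \<integral>\<^sup>+x. f j x \<partial>gauss_vec k)"
proof -
  interpret P: product_prob_space "\<lambda>_::nat. gauss_vec k" UNIV
    by (simp add: product_prob_space_def product_prob_space_axioms_def product_sigma_finite_def
        prob_space_gauss_vec prob_space_imp_sigma_finite)
  have "(\<Prod>j\<in>J. \<integral>\<^sup>+x. f j x \<partial>gauss_vec k) = (\<integral>\<^sup>+x. (\<Prod>j\<in>J. f j (x j)) \<partial>Pi\<^sub>M J (\<lambda>_. gauss_vec k))"
    by (rule P.product_nn_integral_prod[symmetric]) (use assms in auto)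
  also have "\<dots> = (\<integral>\<^sup>+x. (\<Prod>j\<in>J. f j (x j)) \<partial>distr (gauss_seq k) (Pi\<^sub>M J (\<lambda>_. gauss_vec k)) (\<lambda>x. restrict x J))"
    by (subst P.distr_PiM_restrict_finite) (use assms in auto)
  also have "\<dots> = (\<integral>\<^sup>+x. (\<Prod>j\<in>J. f j (restrict x J j)) \<partial>gauss_seq k)"
    by (subst nn_integral_distr) (use assms in \<open>auto intro!: borel_measurable_prod\<close>)
  also have "\<dots> = (\<integral>\<^sup>+x. (\<Prod>j\<in>J. f j (x j)) \<partial>gauss_seq k)"
    by (intro nn_integral_cong prod.cong) auto
  finally show ?thesis by simp
qed

text \<open>The factor one half is dictated by the permanental normalisation: halved squares of a
  centred Gaussian vector with covariance \<open>K\<close> have Laplace transform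
  \<open>det (1 + K * S)\<close> to the power -1/2, and adding \<open>k\<close> independent copies
  gives the exponent \<open>k / 2\<close>.\<close>

definition half_norm2 :: "nat \<Rightarrow> (nat \<Rightarrow> real) \<Rightarrow> real" where
  "half_norm2 k x = (\<Sum>j<k. (x j)\<^sup>2) / 2"

lemma half_norm2_nonneg: "0 \<le> half_norm2 k x"
  by (simp add: half_norm2_def sum_nonneg)

lemma measurable_gauss_vec_component [measurable]: "j < k \<Longrightarrow> (\<lambda>x. x j) \<in> borel_measurable (gauss_vec k)"
  using measurable_component_singleton[of j "{..<k}" "\<lambda>_. std_gauss"] by simp

lemma measurable_gauss_seq_component:
  "j < k \<Longrightarrow> (\<lambda>x. x n j) \<in> borel_measurable (gauss_seq k)"
  using measurable_compose[OF measurable_component_singleton[of n UNIV "\<lambda>_. gauss_vec k"]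
      measurable_gauss_vec_component] by simp

text \<open>A noncentral chi-square transform with centre \<open>z\<close>. The weight
  \<open>s / (1 + l * s)\<close> left on the centre is the \<open>a\<close> of the determinant
  formula.\<close>

lemma nn_integral_gauss_vec_exp_half_norm2:
  fixes s l :: real
  assumes s: "0 \<le> s" and l: "0 \<le> l"
  shows "(\<integral>\<^sup>+x. ennreal (exp (- s * half_norm2 k (\<lambda>j. sqrt l * x j + z j))) \<partial>gauss_vec k)
    = ennreal ((1 + l * s) powr (- real k / 2) * exp (- (s / (1 + l * s)) * half_norm2 k z))"
proof -
  have p: "0 < 1 + s * l" using s l by (simp add: add_pos_nonneg)
  have split: "exp (- s * half_norm2 k (\<lambda>j. sqrt l * x j + z j))
      = (\<Prod>j<k. exp (- (s * l * (x j)\<^sup>2 + 2 * (s * sqrt l * z j) * x j + s * (z j)\<^sup>2) / 2))" for x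
  proof -
    have "- s * half_norm2 k (\<lambda>j. sqrt l * x j + z j) = (\<Sum>j<k. - (s * (sqrt l * x j + z j)\<^sup>2) / 2)"
      by (simp add: half_norm2_def sum_distrib_left sum_divide_distrib sum_negf)
    also have "\<dots> = (\<Sum>j<k. - (s * l * (x j)\<^sup>2 + 2 * (s * sqrt l * z j) * x j + s * (z j)\<^sup>2) / 2)"
      using l by (intro sum.cong) (auto simp: power2_sum power_mult_distrib algebra_simps)
    finally show ?thesis by (simp add: exp_sum)
  qed
  have factor: "(\<integral>\<^sup>+x. ennreal (exp (- (s * l * x\<^sup>2 + 2 * (s * sqrt l * z j) * x + s * (z j)\<^sup>2) / 2)) \<partial>std_gauss)
      = ennreal (1 / sqrt (1 + l * s) * exp (- (s / (1 + l * s)) * ((z j)\<^sup>2 / 2)))" for j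
  proof -
    have "s * (z j)\<^sup>2 - (s * sqrt l * z j)\<^sup>2 / (1 + s * l) = s / (1 + l * s) * (z j)\<^sup>2"
      using p l by (simp add: power_mult_distrib field_simps power2_eq_square)
    then show ?thesis
      unfolding nn_integral_gauss_exp_quadratic[OF p] by (simp add: mult.commute)
  qed
  have "(\<integral>\<^sup>+x. ennreal (exp (- s * half_norm2 k (\<lambda>j. sqrt l * x j + z j))) \<partial>gauss_vec k)
      = (\<integral>\<^sup>+x. (\<Prod>j<k. ennreal (exp (- (s * l * (x j)\<^sup>2 + 2 * (s * sqrt l * z j) * x j + s * (z j)\<^sup>2) / 2))) \<partial>gauss_vec k)"
    unfolding split by (simp add: prod_ennreal)
  also have "\<dots> = (\<Prod>j<k. ennreal (1 / sqrt (1 + l * s) * exp (- (s / (1 + l * s)) * ((z j)\<^sup>2 / 2))))"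
    by (subst nn_integral_gauss_vec_prod) (auto simp only: factor, measurable)
  also have "\<dots> = ennreal (\<Prod>j<k. 1 / sqrt (1 + l * s) * exp (- (s / (1 + l * s)) * ((z j)\<^sup>2 / 2)))"
    using p by (intro prod_ennreal) (auto simp: mult.commute)
  also have "(\<Prod>j<k. 1 / sqrt (1 + l * s) * exp (- (s / (1 + l * s)) * ((z j)\<^sup>2 / 2)))
      = (1 / sqrt (1 + l * s)) ^ k * exp (- (s / (1 + l * s)) * half_norm2 k z)"
    by (simp only: prod.distrib prod_constant card_lessThan exp_sum[symmetric] finite_lessThan
        sum_distrib_left[symmetric] half_norm2_def sum_divide_distrib[symmetric])
  also have "(1 / sqrt (1 + l * s)) ^ k = (1 + l * s) powr (- real k / 2)"
  proof -
    have "1 / sqrt (1 + l * s) = (1 + l * s) powr (- 1 / 2)"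
      using p by (simp add: powr_minus_divide powr_half_sqrt mult.commute)
    then show ?thesis using p by (simp add: powr_realpow[symmetric] powr_powr mult.commute)
  qed
  finally show ?thesis .
qed

text \<open>Given the common vector \<open>fst \<omega>\<close> the summands are independent, and
  integrating that vector out uses the noncentral formula again. The outcome is the determinant
  formula with \<open>F = G = 1\<close>: there the bracket is
  \<open>(1 + A)\<^sup>2 - A\<^sup>2 = 1 + 2 * A\<close>, where \<open>A\<close> is the sum of the
  weights.\<close>

lemma nn_integral_noncentral_laplace:
  fixes L s :: "nat \<Rightarrow> real"
  assumes L: "\<And>i. 0 \<le> L i" and s: "\<And>i. 0 \<le> s i"
  shows "(\<integral>\<^sup>+\<omega>. ennreal (exp (- (\<Sum>i<n. s i * half_norm2 k (\<lambda>j. sqrt (L i) * snd \<omega> (m + i) j + sqrt 2 * fst \<omega> j))))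
      \<partial>(gauss_vec k \<Otimes>\<^sub>M gauss_seq k))
    = ennreal (1 / ((\<Prod>i<n. 1 + L i * s i) * (1 + 2 * (\<Sum>i<n. s i / (1 + L i * s i)))) powr (real k / 2))"
proof -
  interpret S: prob_space "gauss_seq k" by (rule prob_space_gauss_seq)
  have p: "0 < 1 + L i * s i" for i using L s by (simp add: add_pos_nonneg)
  let ?h = "\<lambda>i x y. exp (- s i * half_norm2 k (\<lambda>j. sqrt (L i) * x j + y j))"
  let ?a = "\<Sum>i<n. s i / (1 + L i * s i)"
  have a: "0 \<le> ?a" using p s by (intro sum_nonneg) (auto intro!: divide_nonneg_pos)
  have meas [measurable]: "(\<lambda>x. ennreal (?h i x y)) \<in> borel_measurable (gauss_vec k)" for i y
    unfolding half_norm2_def by measurable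
  have inner: "(\<integral>\<^sup>+\<xi>. ennreal (exp (- (\<Sum>i<n. s i * half_norm2 k (\<lambda>j. sqrt (L i) * \<xi> (m + i) j + y j)))) \<partial>gauss_seq k)
      = ennreal (\<Prod>i<n. (1 + L i * s i) powr (- real k / 2)) * ennreal (exp (- ?a * half_norm2 k y))" for y
  proof -
    have "(\<integral>\<^sup>+\<xi>. ennreal (exp (- (\<Sum>i<n. s i * half_norm2 k (\<lambda>j. sqrt (L i) * \<xi> (m + i) j + y j)))) \<partial>gauss_seq k)
        = (\<integral>\<^sup>+\<xi>. (\<Prod>q\<in>(\<lambda>i. m + i) ` {..<n}. ennreal (?h (q - m) (\<xi> q) y)) \<partial>gauss_seq k)"
      by (simp add: prod.reindex sum_negf[symmetric] exp_sum prod_ennreal)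
    also have "\<dots> = (\<Prod>q\<in>(\<lambda>i. m + i) ` {..<n}. \<integral>\<^sup>+x. ennreal (?h (q - m) x y) \<partial>gauss_vec k)"
      by (rule nn_integral_gauss_seq_prod) (simp, rule meas)
    also have "\<dots> = (\<Prod>i<n. \<integral>\<^sup>+x. ennreal (?h i x y) \<partial>gauss_vec k)"
      by (simp add: prod.reindex)
    also have "\<dots> = (\<Prod>i<n. ennreal ((1 + L i * s i) powr (- real k / 2) * exp (- (s i / (1 + L i * s i)) * half_norm2 k y)))"
      by (intro prod.cong nn_integral_gauss_vec_exp_half_norm2 L s) simp
    also have "\<dots> = ennreal (\<Prod>i<n. (1 + L i * s i) powr (- real k / 2) * exp (- (s i / (1 + L i * s i)) * half_norm2 k y))"
      by (rule prod_ennreal) simp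
    also have "(\<Prod>i<n. (1 + L i * s i) powr (- real k / 2) * exp (- (s i / (1 + L i * s i)) * half_norm2 k y))
        = (\<Prod>i<n. (1 + L i * s i) powr (- real k / 2)) * exp (- ?a * half_norm2 k y)"
      by (simp only: prod.distrib exp_sum[symmetric] finite_lessThan sum_distrib_right[symmetric] sum_negf)
    finally show ?thesis by (simp add: ennreal_mult prod_nonneg)
  qed
  have "(\<integral>\<^sup>+\<omega>. ennreal (exp (- (\<Sum>i<n. s i * half_norm2 k (\<lambda>j. sqrt (L i) * snd \<omega> (m + i) j + sqrt 2 * fst \<omega> j))))
      \<partial>(gauss_vec k \<Otimes>\<^sub>M gauss_seq k))
    = (\<integral>\<^sup>+\<eta>. \<integral>\<^sup>+\<xi>. ennreal (exp (- (\<Sum>i<n. s i * half_norm2 k (\<lambda>j. sqrt (L i) * \<xi> (m + i) j + sqrt 2 * \<eta> j))))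
      \<partial>gauss_seq k \<partial>gauss_vec k)"
  proof (subst S.nn_integral_fst[symmetric])
    have [measurable]: "(\<lambda>\<omega>. snd \<omega> i j) \<in> borel_measurable (gauss_vec k \<Otimes>\<^sub>M gauss_seq k)" if "j < k" for i j
      by (rule measurable_compose[OF measurable_snd measurable_gauss_seq_component[OF that]])
    have [measurable]: "(\<lambda>\<omega>. fst \<omega> j) \<in> borel_measurable (gauss_vec k \<Otimes>\<^sub>M gauss_seq k)" if "j < k" for j
      by (rule measurable_compose[OF measurable_fst measurable_gauss_vec_component[OF that]])
    show "(\<lambda>\<omega>. ennreal (exp (- (\<Sum>i<n. s i * half_norm2 k (\<lambda>j. sqrt (L i) * snd \<omega> (m + i) j + sqrt 2 * fst \<omega> j)))))
        \<in> borel_measurable (gauss_vec k \<Otimes>\<^sub>M gauss_seq k)"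
      unfolding half_norm2_def by measurable
  qed simp
  \<comment> \<open>The summand 0 brings the integrand to the noncentral form with centre 0 and
    \<open>l = 2\<close>.\<close>
  also have "\<dots> = (\<integral>\<^sup>+\<eta>. ennreal (\<Prod>i<n. (1 + L i * s i) powr (- real k / 2)) *
      ennreal (exp (- ?a * half_norm2 k (\<lambda>j. sqrt 2 * \<eta> j + 0))) \<partial>gauss_vec k)"
    by (simp add: inner)
  also have "\<dots> = ennreal (\<Prod>i<n. (1 + L i * s i) powr (- real k / 2)) *
      (\<integral>\<^sup>+\<eta>. ennreal (exp (- ?a * half_norm2 k (\<lambda>j. sqrt 2 * \<eta> j + 0))) \<partial>gauss_vec k)"
    by (rule nn_integral_cmult) (simp add: half_norm2_def)
  also have "\<dots> = ennreal (\<Prod>i<n. (1 + L i * s i) powr (- real k / 2)) * ennreal ((1 + 2 * ?a) powr (- real k / 2))"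
    using a by (subst nn_integral_gauss_vec_exp_half_norm2) (auto simp: half_norm2_def)
  also have "\<dots> = ennreal ((\<Prod>i<n. (1 + L i * s i) powr (- real k / 2)) * (1 + 2 * ?a) powr (- real k / 2))"
    by (simp add: ennreal_mult prod_nonneg)
  also have "(\<Prod>i<n. (1 + L i * s i) powr (- real k / 2)) * (1 + 2 * ?a) powr (- real k / 2)
      = 1 / ((\<Prod>i<n. 1 + L i * s i) * (1 + 2 * ?a)) powr (real k / 2)"
  proof -
    have "(\<Prod>i<n. (1 + L i * s i) powr (- real k / 2)) = (\<Prod>i<n. 1 + L i * s i) powr (- real k / 2)"
      by (rule prod_powr_distrib[symmetric])
    then show ?thesis
      using p a by (simp add: powr_mult less_imp_le prod_nonneg powr_minus_divide)
  qed
  finally show ?thesis .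
qed

section \<open>Upper and lower limits from cluster points\<close>

lemma limsup_ereal_eqI:
  fixes x :: "nat \<Rightarrow> real"
  assumes up: "\<And>e. 0 < e \<Longrightarrow> \<forall>\<^sub>F n in sequentially. x n < c + e"
    and low: "\<And>e. 0 < e \<Longrightarrow> \<exists>\<^sub>F n in sequentially. c - e < x n"
  shows "limsup (\<lambda>n. ereal (x n)) = ereal c"
proof (rule antisym)
  show "limsup (\<lambda>n. ereal (x n)) \<le> ereal c"
  proof (rule ereal_le_epsilon2)
    fix e :: real assume "0 < e"
    then have "\<forall>\<^sub>F n in sequentially. ereal (x n) \<le> ereal (c + e)"
      using up[OF \<open>0 < e\<close>] by (auto elim!: eventually_mono)
    then have "limsup (\<lambda>n. ereal (x n)) \<le> ereal (c + e)" by (rule Limsup_bounded)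
    then show "limsup (\<lambda>n. ereal (x n)) \<le> ereal c + ereal e" by simp
  qed
  show "ereal c \<le> limsup (\<lambda>n. ereal (x n))"
  proof (rule ccontr)
    assume "\<not> ?thesis"
    then have "limsup (\<lambda>n. ereal (x n)) < ereal c" by simp
    then obtain y where y: "limsup (\<lambda>n. ereal (x n)) < ereal y" "ereal y < ereal c"
      using ereal_dense2 by blast
    then have "\<forall>\<^sub>F n in sequentially. ereal (x n) < ereal y" using Limsup_lessD by blast
    then have "\<forall>\<^sub>F n in sequentially. \<not> c - (c - y) < x n" by (auto elim!: eventually_mono)
    moreover have "\<exists>\<^sub>F n in sequentially. c - (c - y) < x n" by (rule low) (use y in simp)
    ultimately show False by (simp add: frequently_def)
  qed
qed

lemma liminf_ereal_eqI:
  fixes x :: "nat \<Rightarrow> real"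
  assumes low: "\<And>e. 0 < e \<Longrightarrow> \<forall>\<^sub>F n in sequentially. c - e < x n"
    and up: "\<And>e. 0 < e \<Longrightarrow> \<exists>\<^sub>F n in sequentially. x n < c + e"
  shows "liminf (\<lambda>n. ereal (x n)) = ereal c"
proof -
  have "limsup (\<lambda>n. ereal (- x n)) = ereal (- c)"
  proof (rule limsup_ereal_eqI)
    show "\<forall>\<^sub>F n in sequentially. - x n < - c + e" if "0 < e" for e
      using low[OF that] by (auto elim!: eventually_mono)
    show "\<exists>\<^sub>F n in sequentially. - c - e < - x n" if "0 < e" for e
      using up[OF that] by (auto elim!: frequently_elim1)
  qed
  moreover have "limsup (\<lambda>n. - ereal (x n)) = - liminf (\<lambda>n. ereal (x n))"
    by (rule ereal_Limsup_uminus)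
  ultimately have "- liminf (\<lambda>n. ereal (x n)) = - ereal c" by simp
  then show ?thesis by (simp only: ereal_uminus_eq_iff)
qed

text \<open>For a standard Gaussian vector \<open>\<xi>\<close> in dimension \<open>k\<close>, \<open>w = \<xi> n / sqrt (ln n)\<close> and a unit vector
  \<open>e\<close>, the locale is used with \<open>p n = w \<bullet> e\<close> and \<open>t n = w \<bullet> w\<close>; the cluster set of \<open>w\<close> is the ball
  of radius \<open>sqrt 2\<close>.\<close>

locale cluster_limits =
  fixes p t r q :: "nat \<Rightarrow> real" and b \<rho> :: real
  assumes pt: "\<And>n. (p n)\<^sup>2 \<le> t n"
    and t_upper: "\<And>d. 0 < d \<Longrightarrow> \<forall>\<^sub>F n in sequentially. t n < 2 + d"
    and cluster: "\<And>c d. c \<in> \<rat> \<Longrightarrow> c\<^sup>2 < 2 \<Longrightarrow> 0 < d \<Longrightarrow>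
      \<exists>\<^sub>F n in sequentially. \<bar>p n - c\<bar> < d \<and> \<bar>t n - c\<^sup>2\<bar> < d"
    and r: "r \<longlonglongrightarrow> b" and r_nonneg: "\<And>n. 0 \<le> r n" and \<rho>: "0 \<le> \<rho>"
    and q: "\<forall>\<^sub>F n in sequentially. q n = \<rho> * p n + r n * t n / 2"
begin

lemma b_nonneg: "0 \<le> b"
  by (rule LIMSEQ_le_const[OF r]) (use r_nonneg in auto)

lemma t_nonneg: "0 \<le> t n"
  using pt[of n] zero_le_power2[of "p n"] by linarith

lemma p_abs_le: "\<bar>p n\<bar> \<le> sqrt (t n)"
  using real_sqrt_le_mono[OF pt[of n]] by simp

text \<open>The value \<open>\<rho> * c + b * c\<^sup>2 / 2\<close> is the limit of \<open>q\<close>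
  along times when \<open>w\<close> approaches the point \<open>c * e\<close>. Only rational
  \<open>c\<close> are available, because the cluster property will hold almost surely for countably
  many \<open>c\<close> at once.\<close>

lemma frequently_near_rat:
  assumes c: "c \<in> \<rat>" "c\<^sup>2 < 2" and e: "0 < e"
  shows "\<exists>\<^sub>F n in sequentially. \<bar>q n - (\<rho> * c + b * c\<^sup>2 / 2)\<bar> < e"
proof -
  \<comment> \<open>One summand for each error term: \<open>\<rho> * d\<close> from
    \<open>p\<close>, \<open>(b + 1) * d\<close> from \<open>t\<close> (as \<open>r n\<close> is at
    most \<open>b + 1\<close>), and \<open>d\<close> from \<open>r\<close> (as
    \<open>c\<^sup>2 / 2\<close> is below 1).\<close>
  define K where "K = \<rho> + (b + 1) + 1"
  define d where "d = min 1 (e / (2 * K))"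
  have K: "0 < K" using \<rho> b_nonneg by (simp add: K_def)
  have d: "0 < d" "d \<le> 1" "d * K < e"
  proof -
    show "0 < d" "d \<le> 1" using e K by (auto simp: d_def)
    have "d * K \<le> e / (2 * K) * K" using K by (intro mult_right_mono) (auto simp: d_def)
    then show "d * K < e" using e K by simp
  qed
  have "\<forall>\<^sub>F n in sequentially. \<bar>r n - b\<bar> < d"
    using tendstoD[OF r d(1)] by (simp add: dist_real_def)
  with cluster[OF c d(1)] q show ?thesis
  proof (rule frequently_rev_mp[OF _ eventually_elim2])
    fix n assume r: "\<bar>r n - b\<bar> < d" and q: "q n = \<rho> * p n + r n * t n / 2"
    show "\<bar>p n - c\<bar> < d \<and> \<bar>t n - c\<^sup>2\<bar> < d \<longrightarrow> \<bar>q n - (\<rho> * c + b * c\<^sup>2 / 2)\<bar> < e"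
    proof
      assume h: "\<bar>p n - c\<bar> < d \<and> \<bar>t n - c\<^sup>2\<bar> < d"
      have "q n - (\<rho> * c + b * c\<^sup>2 / 2) = \<rho> * (p n - c) + (r n * (t n - c\<^sup>2) / 2 + (r n - b) * c\<^sup>2 / 2)"
        unfolding q by (simp add: field_simps)
      also have "\<bar>\<dots>\<bar> \<le> \<bar>\<rho> * (p n - c)\<bar> + (\<bar>r n * (t n - c\<^sup>2) / 2\<bar> + \<bar>(r n - b) * c\<^sup>2 / 2\<bar>)"
          using abs_triangle_ineq[of "\<rho> * (p n - c)" "r n * (t n - c\<^sup>2) / 2 + (r n - b) * c\<^sup>2 / 2"]
          abs_triangle_ineq[of "r n * (t n - c\<^sup>2) / 2" "(r n - b) * c\<^sup>2 / 2"] by linarith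
      also have "\<bar>\<rho> * (p n - c)\<bar> \<le> \<rho> * d"
        using \<rho> h by (simp add: abs_mult mult_left_mono)
      also have "\<bar>r n * (t n - c\<^sup>2) / 2\<bar> \<le> (b + 1) * d"
      proof -
        have "\<bar>r n\<bar> * \<bar>t n - c\<^sup>2\<bar> \<le> (b + 1) * d"
          using r h d r_nonneg[of n] b_nonneg by (intro mult_mono) auto
        moreover have "0 \<le> (b + 1) * d" using b_nonneg d by simp
        ultimately show ?thesis by (simp add: abs_mult)
      qed
      also have "\<bar>(r n - b) * c\<^sup>2 / 2\<bar> \<le> d * 1"
      proof -
        have "\<bar>r n - b\<bar> * (c\<^sup>2 / 2) \<le> d * 1"
          using r c d by (intro mult_mono) auto
        then show ?thesis by (simp add: abs_mult)
      qed
      finally show "\<bar>q n - (\<rho> * c + b * c\<^sup>2 / 2)\<bar> < e"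
        using d(3) by (simp add: K_def algebra_simps)
    qed
  qed
qed

text \<open>Continuity in \<open>c\<close> and density of the rationals extend the cluster property
  to the closed interval, in particular to the endpoints, where extreme values are taken.\<close>

lemma frequently_near:
  assumes c: "\<bar>c\<bar> \<le> sqrt 2" and e: "0 < e"
  shows "\<exists>\<^sub>F n in sequentially. \<bar>q n - (\<rho> * c + b * c\<^sup>2 / 2)\<bar> < e"
proof -
  have "isCont (\<lambda>c. \<rho> * c + b * c\<^sup>2 / 2) c" by (intro continuous_intros) simp_all
  then have "\<exists>d>0. \<forall>c'. \<bar>c' - c\<bar> < d \<longrightarrow> \<bar>(\<rho> * c' + b * c'\<^sup>2 / 2) - (\<rho> * c + b * c\<^sup>2 / 2)\<bar> < e / 2"
    unfolding continuous_at_eps_delta dist_real_def using half_gt_zero[OF e] by blast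
  then obtain d where d: "0 < d"
    "\<And>c'. \<bar>c' - c\<bar> < d \<Longrightarrow> \<bar>(\<rho> * c' + b * c'\<^sup>2 / 2) - (\<rho> * c + b * c\<^sup>2 / 2)\<bar> < e / 2"
    by blast
  have s: "0 < sqrt 2" by simp
  have "max (c - d) (- sqrt 2) < min (c + d) (sqrt 2)"
    using c d(1) s by (simp add: abs_le_iff)
  then obtain c' where c': "c' \<in> \<rat>" "max (c - d) (- sqrt 2) < c'" "c' < min (c + d) (sqrt 2)"
    using Rats_dense_in_real by blast
  have "\<bar>c'\<bar> < sqrt 2" using c' by (simp add: abs_less_iff)
  then have "c'\<^sup>2 < 2" using real_sqrt_less_iff[of "c'\<^sup>2" 2] by simp
  from frequently_near_rat[OF c'(1) this half_gt_zero[OF e]]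
  show ?thesis
  proof (rule frequently_elim1)
    fix n assume "\<bar>q n - (\<rho> * c' + b * c'\<^sup>2 / 2)\<bar> < e / 2"
    moreover have "\<bar>(\<rho> * c' + b * c'\<^sup>2 / 2) - (\<rho> * c + b * c\<^sup>2 / 2)\<bar> < e / 2"
      by (rule d(2)) (use c' in \<open>simp add: abs_less_iff\<close>)
    ultimately show "\<bar>q n - (\<rho> * c + b * c\<^sup>2 / 2)\<bar> < e" by linarith
  qed
qed

lemma eventually_abs_less:
  assumes e: "0 < e"
  shows "\<forall>\<^sub>F n in sequentially. \<bar>q n\<bar> < sqrt 2 * \<rho> + b + e"
proof -
  \<comment> \<open>The bound for radius \<open>sqrt (2 + d)\<close> is continuous in
    \<open>d\<close>, which provides a positive \<open>d\<close> whose excess is below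
    \<open>e\<close>.\<close>
  have "((\<lambda>d. \<rho> * sqrt (2 + d) + (b + d) * (2 + d) / 2) \<longlongrightarrow> \<rho> * sqrt (2 + 0) + (b + 0) * (2 + 0) / 2) (at_right 0)"
    by (intro tendsto_intros) simp_all
  then have "\<forall>\<^sub>F d in at_right 0. \<rho> * sqrt (2 + d) + (b + d) * (2 + d) / 2 < sqrt 2 * \<rho> + b + e"
    by (rule order_tendstoD) (use e in \<open>simp add: mult.commute\<close>)
  then have "\<forall>\<^sub>F d in at_right 0. 0 < d \<and> \<rho> * sqrt (2 + d) + (b + d) * (2 + d) / 2 < sqrt 2 * \<rho> + b + e"
    by (rule eventually_conj[OF eventually_at_right_less])
  then obtain d where d: "0 < d" "\<rho> * sqrt (2 + d) + (b + d) * (2 + d) / 2 < sqrt 2 * \<rho> + b + e"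
    using eventually_happens'[OF trivial_limit_at_right_real] by blast
  have "\<forall>\<^sub>F n in sequentially. r n < b + d" using order_tendstoD(2)[OF r, of "b + d"] d by simp
  with q t_upper[OF d(1)] show ?thesis
  proof eventually_elim
    case (elim n)
    have "\<bar>q n\<bar> \<le> \<bar>\<rho> * p n\<bar> + \<bar>r n * t n / 2\<bar>" unfolding elim(1) by (rule abs_triangle_ineq)
    also have "\<bar>\<rho> * p n\<bar> \<le> \<rho> * sqrt (2 + d)"
    proof -
      have "\<bar>p n\<bar> \<le> sqrt (2 + d)" using p_abs_le[of n] elim(2) by (meson less_imp_le order_trans real_sqrt_le_iff)
      then show ?thesis using \<rho> by (simp add: abs_mult mult_left_mono)
    qed
    also have "\<bar>r n * t n / 2\<bar> \<le> (b + d) * (2 + d) / 2"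
    proof -
      have "r n * t n \<le> (b + d) * (2 + d)"
        using elim r_nonneg t_nonneg b_nonneg d(1) by (intro mult_mono) auto
      then show ?thesis using r_nonneg[of n] t_nonneg[of n] by simp
    qed
    finally show ?case using d(2) by simp
  qed
qed

text \<open>The maximum over the ball is at \<open>c = sqrt 2\<close>, in the direction of
  \<open>e\<close>; it also dominates the absolute values, so the next lemma has the same
  limit.\<close>

lemma limsup_eq: "limsup (\<lambda>n. ereal (q n)) = ereal (b + sqrt 2 * \<rho>)"
proof (rule limsup_ereal_eqI)
  show "\<forall>\<^sub>F n in sequentially. q n < b + sqrt 2 * \<rho> + e" if "0 < e" for e
    using eventually_abs_less[OF that] by (auto elim!: eventually_mono)
  show "\<exists>\<^sub>F n in sequentially. b + sqrt 2 * \<rho> - e < q n" if "0 < e" for e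
    using frequently_near[of "sqrt 2", OF _ that] by (auto elim!: frequently_elim1 simp: abs_less_iff mult.commute)
qed

lemma limsup_abs_eq: "limsup (\<lambda>n. ereal \<bar>q n\<bar>) = ereal (b + sqrt 2 * \<rho>)"
proof (rule limsup_ereal_eqI)
  show "\<forall>\<^sub>F n in sequentially. \<bar>q n\<bar> < b + sqrt 2 * \<rho> + e" if "0 < e" for e
    using eventually_abs_less[OF that] by (auto elim!: eventually_mono)
  show "\<exists>\<^sub>F n in sequentially. b + sqrt 2 * \<rho> - e < \<bar>q n\<bar>" if "0 < e" for e
    using frequently_near[of "sqrt 2", OF _ that] by (auto elim!: frequently_elim1 simp: abs_less_iff mult.commute)
qed

text \<open>The hypothesis places the vertex \<open>c = - \<rho> / b\<close> of the parabola
  \<open>\<rho> * c + b * c\<^sup>2 / 2\<close> inside the ball, so the minimum is the vertex value.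
  The lower bound needs only that \<open>t n\<close> is at least \<open>(p n)\<^sup>2\<close>, by
  completing the square with \<open>r n\<close> in place of \<open>b\<close>.\<close>

lemma liminf_eq_small:
  assumes "\<rho>\<^sup>2 / 2 < b\<^sup>2"
  shows "liminf (\<lambda>n. ereal (q n)) = ereal (- (\<rho>\<^sup>2 / 2) / b)"
proof (rule liminf_ereal_eqI)
  have b: "0 < b" using assms b_nonneg by (cases "b = 0") (auto simp: divide_less_eq)
  fix e :: real assume e: "0 < e"
  have "(\<lambda>n. - (\<rho>\<^sup>2 / 2) / r n) \<longlonglongrightarrow> - (\<rho>\<^sup>2 / 2) / b" by (intro tendsto_intros r) (use b in simp_all)
  then have "\<forall>\<^sub>F n in sequentially. - (\<rho>\<^sup>2 / 2) / b - e < - (\<rho>\<^sup>2 / 2) / r n"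
    by (rule order_tendstoD) (use e in simp)
  with q order_tendstoD(1)[OF r b]
  show "\<forall>\<^sub>F n in sequentially. - (\<rho>\<^sup>2 / 2) / b - e < q n"
  proof eventually_elim
    case (elim n)
    have "- (\<rho>\<^sup>2 / 2) / r n \<le> \<rho> * p n + r n * (p n)\<^sup>2 / 2"
    proof -
      have "\<rho> * p n + r n * (p n)\<^sup>2 / 2 - - (\<rho>\<^sup>2 / 2) / r n = (\<rho> + r n * p n)\<^sup>2 / (2 * r n)"
        using elim(2) by (simp add: field_simps power2_eq_square)
      moreover have "0 \<le> (\<rho> + r n * p n)\<^sup>2 / (2 * r n)" using elim(2) by simp
      ultimately show ?thesis by linarith
    qed
    also have "\<dots> \<le> q n" unfolding elim(1) using pt[of n] elim(2) by (simp add: mult_left_mono)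
    finally show ?case using elim(3) by simp
  qed
  have "\<rho>\<^sup>2 < (sqrt 2 * b)\<^sup>2" using assms by (simp add: power_mult_distrib)
  then have "\<rho> < sqrt 2 * b" by (rule power2_less_imp_less) (use b in simp)
  then have "\<bar>- \<rho> / b\<bar> \<le> sqrt 2" using \<rho> b by (simp add: pos_divide_le_eq)
  from frequently_near[OF this e]
  show "\<exists>\<^sub>F n in sequentially. q n < - (\<rho>\<^sup>2 / 2) / b + e"
  proof (rule frequently_elim1)
    fix n assume "\<bar>q n - (\<rho> * (- \<rho> / b) + b * (- \<rho> / b)\<^sup>2 / 2)\<bar> < e"
    moreover have "\<rho> * (- \<rho> / b) + b * (- \<rho> / b)\<^sup>2 / 2 = - (\<rho>\<^sup>2 / 2) / b"
      using b by (simp add: field_simps power2_eq_square)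
    ultimately show "q n < - (\<rho>\<^sup>2 / 2) / b + e" by (simp add: abs_less_iff)
  qed
qed

text \<open>The vertex of the parabola is not in the open interval, so the minimum is at the
  boundary point \<open>c = - sqrt 2\<close>.\<close>

lemma liminf_eq_large:
  assumes "b\<^sup>2 \<le> \<rho>\<^sup>2 / 2"
  shows "liminf (\<lambda>n. ereal (q n)) = ereal (b - sqrt 2 * \<rho>)"
proof (rule liminf_ereal_eqI)
  fix e :: real assume e: "0 < e"
  have "(sqrt 2 * b)\<^sup>2 = 2 * b\<^sup>2" by (simp add: power_mult_distrib)
  then have "(sqrt 2 * b)\<^sup>2 \<le> \<rho>\<^sup>2" using assms by linarith
  then have b\<rho>: "sqrt 2 * b \<le> \<rho>" by (rule power2_le_imp_le) (rule \<rho>)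
  have "((\<lambda>d. b - \<rho> * sqrt (2 + d) - d * (2 + d)) \<longlongrightarrow> b - \<rho> * sqrt (2 + 0) - 0 * (2 + 0)) (at_right 0)"
    by (intro tendsto_intros)
  then have "\<forall>\<^sub>F d in at_right 0. b - sqrt 2 * \<rho> - e < b - \<rho> * sqrt (2 + d) - d * (2 + d)"
    by (rule order_tendstoD) (use e in \<open>simp add: mult.commute\<close>)
  then have "\<forall>\<^sub>F d in at_right 0. 0 < d \<and> b - sqrt 2 * \<rho> - e < b - \<rho> * sqrt (2 + d) - d * (2 + d)"
    by (rule eventually_conj[OF eventually_at_right_less])
  then obtain d where d: "0 < d" "b - sqrt 2 * \<rho> - e < b - \<rho> * sqrt (2 + d) - d * (2 + d)"
    using eventually_happens'[OF trivial_limit_at_right_real] by blast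
  have "\<forall>\<^sub>F n in sequentially. b - d < r n" using order_tendstoD(1)[OF r, of "b - d"] d by simp
  with q t_upper[OF d(1)]
  show "\<forall>\<^sub>F n in sequentially. b - sqrt 2 * \<rho> - e < q n"
  proof eventually_elim
    case (elim n)
    define \<sigma> where "\<sigma> = sqrt (t n)"
    have \<sigma>: "0 \<le> \<sigma>" "\<sigma>\<^sup>2 = t n" "\<sigma> \<le> sqrt (2 + d)"
      using t_nonneg[of n] elim(2) by (auto simp: \<sigma>_def)
    \<comment> \<open>Inside the ball the difference to the boundary value factors as
      \<open>(sqrt 2 - \<sigma>) * (\<rho> - b * (sqrt 2 + \<sigma>) / 2)\<close>, and both factors
      are nonnegative since \<open>sqrt 2 * b\<close> is at most \<open>\<rho>\<close>. Outside it,
      the two terms are estimated separately.\<close>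
    have "b - \<rho> * sqrt (2 + d) \<le> b * \<sigma>\<^sup>2 / 2 - \<rho> * \<sigma>"
    proof (cases "\<sigma> \<le> sqrt 2")
      case True
      have "b * \<sigma> \<le> b * sqrt 2" using True b_nonneg by (rule mult_left_mono)
      then have "b * (sqrt 2 + \<sigma>) / 2 \<le> b * sqrt 2" by (simp add: distrib_left)
      then have "0 \<le> (sqrt 2 - \<sigma>) * (\<rho> - b * (sqrt 2 + \<sigma>) / 2)"
        using True b\<rho> by (intro mult_nonneg_nonneg) (auto simp: mult.commute)
      also have "\<dots> = (b * \<sigma>\<^sup>2 / 2 - \<rho> * \<sigma>) - (b - \<rho> * sqrt 2)"
      proof -
        have "sqrt 2 * sqrt 2 = (2 :: real)" by simp
        then show ?thesis by (simp add: power2_eq_square algebra_simps diff_divide_distrib add_divide_distrib)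
      qed
      finally have "b - \<rho> * sqrt 2 \<le> b * \<sigma>\<^sup>2 / 2 - \<rho> * \<sigma>" by simp
      moreover have "\<rho> * sqrt 2 \<le> \<rho> * sqrt (2 + d)" using \<rho> d by (intro mult_left_mono) auto
      ultimately show ?thesis by simp
    next
      case False
      then have "2 \<le> \<sigma>\<^sup>2" using power_mono[of "sqrt 2" \<sigma> 2] by simp
      then have "b * 2 \<le> b * \<sigma>\<^sup>2" using b_nonneg by (intro mult_left_mono)
      moreover have "\<rho> * \<sigma> \<le> \<rho> * sqrt (2 + d)" using \<sigma>(3) \<rho> by (rule mult_left_mono)
      ultimately show ?thesis by simp
    qed
    moreover have "- (d * (2 + d)) \<le> (r n - b) * t n / 2"
    proof -
      have "(- d) * t n \<le> (r n - b) * t n" using elim(3) t_nonneg by (intro mult_right_mono) auto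
      moreover have "d * t n \<le> d * (2 + d)" using elim(2) d by (intro mult_left_mono) auto
      moreover have "0 \<le> d * (2 + d)" using d by simp
      ultimately show ?thesis by simp
    qed
    moreover have "- (\<rho> * \<sigma>) \<le> \<rho> * p n"
    proof -
      have "\<rho> * (- \<sigma>) \<le> \<rho> * p n"
        using p_abs_le[of n] by (intro mult_left_mono \<rho>) (auto simp: \<sigma>_def abs_le_iff)
      then show ?thesis by simp
    qed
    ultimately show ?case using d(2) unfolding elim(1) \<sigma>(2) by (simp add: field_simps)
  qed
  have "\<bar>- sqrt 2\<bar> \<le> sqrt (2 :: real)" by simp
  from frequently_near[OF this e]
  show "\<exists>\<^sub>F n in sequentially. q n < b - sqrt 2 * \<rho> + e"
    by (auto elim!: frequently_elim1 simp: abs_less_iff mult.commute)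
qed

end

section \<open>Borel-Cantelli estimates\<close>

lemma nn_integral_gauss_seq_component:
  assumes "f \<in> borel_measurable (gauss_vec k)"
  shows "(\<integral>\<^sup>+\<omega>. f (\<omega> n) \<partial>gauss_seq k) = (\<integral>\<^sup>+x. f x \<partial>gauss_vec k)"
  using nn_integral_gauss_seq_prod[of "{n}" "\<lambda>_. f" k] assms by simp

lemma measurable_half_norm2 [measurable]: "half_norm2 k \<in> borel_measurable (gauss_vec k)"
  unfolding half_norm2_def[abs_def] by measurable

lemma measurable_gauss_seq_nth [measurable]: "(\<lambda>\<omega>. \<omega> n) \<in> measurable (gauss_seq k) (gauss_vec k)"
  by (rule measurable_component_singleton) simp

text \<open>Chernoff's bound: \<open>K\<close> is the exponential moment of
  \<open>\<theta> * half_norm2 k\<close>, finite for every \<open>\<theta>\<close> below 1.\<close>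

lemma gauss_seq_tail_bound:
  assumes \<theta>: "0 < \<theta>" "\<theta> < 1"
  obtains K where "\<And>n y. measure (gauss_seq k) {\<omega> \<in> space (gauss_seq k). y \<le> half_norm2 k (\<omega> n)} \<le> K * exp (- \<theta> * y)"
proof -
  interpret S: prob_space "gauss_seq k" by (rule prob_space_gauss_seq)
  define K where "K = (\<Prod>j<k. 1 / sqrt (1 - \<theta>))"
  have K: "0 \<le> K" unfolding K_def using \<theta> by (intro prod_nonneg) auto
  have K_eq: "(\<integral>\<^sup>+x. ennreal (exp (\<theta> * half_norm2 k x)) \<partial>gauss_vec k) = ennreal K"
  proof -
    have "exp (\<theta> * half_norm2 k x) = (\<Prod>j<k. exp (- (- \<theta> * (x j)\<^sup>2 + 2 * 0 * x j + 0) / 2))" for x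
      by (simp add: half_norm2_def exp_sum[symmetric] sum_distrib_left sum_divide_distrib)
    then have "(\<integral>\<^sup>+x. ennreal (exp (\<theta> * half_norm2 k x)) \<partial>gauss_vec k)
        = (\<integral>\<^sup>+x. (\<Prod>j<k. ennreal (exp (- (- \<theta> * (x j)\<^sup>2 + 2 * 0 * x j + 0) / 2))) \<partial>gauss_vec k)"
      by (simp add: prod_ennreal)
    also have "\<dots> = (\<Prod>j<k. \<integral>\<^sup>+x. ennreal (exp (- (- \<theta> * x\<^sup>2 + 2 * 0 * x + 0) / 2)) \<partial>std_gauss)"
      by (rule nn_integral_gauss_vec_prod[where f = "\<lambda>_ x. ennreal (exp (- (- \<theta> * x\<^sup>2 + 2 * 0 * x + 0) / 2))"]) measurable
    also have "\<dots> = (\<Prod>j<k. ennreal (1 / sqrt (1 - \<theta>)))"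
      using \<theta> by (subst nn_integral_gauss_exp_quadratic) auto
    also have "\<dots> = ennreal K" unfolding K_def using \<theta> by (intro prod_ennreal) auto
    finally show ?thesis .
  qed
  have "measure (gauss_seq k) {\<omega> \<in> space (gauss_seq k). y \<le> half_norm2 k (\<omega> n)} \<le> K * exp (- \<theta> * y)" for n y
  proof -
    have "{\<omega> \<in> space (gauss_seq k). y \<le> half_norm2 k (\<omega> n)}
        = {\<omega> \<in> space (gauss_seq k). 1 \<le> ennreal (exp (- \<theta> * y)) * ennreal (exp (\<theta> * half_norm2 k (\<omega> n)))}"
      using \<theta> by (simp add: ennreal_mult[symmetric] mult_exp_exp)
    then have "emeasure (gauss_seq k) {\<omega> \<in> space (gauss_seq k). y \<le> half_norm2 k (\<omega> n)}
        \<le> ennreal (exp (- \<theta> * y)) * (\<integral>\<^sup>+\<omega>. ennreal (exp (\<theta> * half_norm2 k (\<omega> n))) * indicator (space (gauss_seq k)) \<omega> \<partial>gauss_seq k)"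
      by (simp only:) (rule nn_integral_Markov_inequality, measurable)
    also have "(\<integral>\<^sup>+\<omega>. ennreal (exp (\<theta> * half_norm2 k (\<omega> n))) * indicator (space (gauss_seq k)) \<omega> \<partial>gauss_seq k) = ennreal K"
      unfolding K_eq[symmetric]
      by (subst nn_integral_gauss_seq_component[symmetric, of _ _ n]) (auto intro!: nn_integral_cong)
    finally show ?thesis using K
      by (simp add: S.emeasure_eq_measure ennreal_mult[symmetric] mult.commute)
  qed
  then show thesis by (rule that)
qed

lemma AE_gauss_seq_norm_upper:
  "AE \<omega> in gauss_seq k. \<forall>d>0. \<forall>\<^sub>F n in sequentially. (\<Sum>j<k. (\<omega> n j)\<^sup>2) / ln (real n) < 2 + d"
proof -
  interpret S: prob_space "gauss_seq k" by (rule prob_space_gauss_seq)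
  have bound: "AE \<omega> in gauss_seq k. \<forall>\<^sub>F n in sequentially. half_norm2 k (\<omega> n) < (1 + d / 2) * ln (real n)"
    if d: "0 < d" for d
  proof -
    \<comment> \<open>With this choice \<open>\<theta> * (1 + d / 2)\<close> exceeds 1, so the tail
      bound at level \<open>(1 + d / 2) * ln n\<close> is a summable power of
      \<open>n\<close>.\<close>
    define \<theta> where "\<theta> = 1 / (1 + d / 4)"
    have \<theta>: "0 < \<theta>" "\<theta> < 1" using d by (auto simp: \<theta>_def)
    obtain K where K: "\<And>n y. measure (gauss_seq k) {\<omega> \<in> space (gauss_seq k). y \<le> half_norm2 k (\<omega> n)} \<le> K * exp (- \<theta> * y)"
      using gauss_seq_tail_bound[OF \<theta>] by blast
    define A where "A n = {\<omega> \<in> space (gauss_seq k). (1 + d / 2) * ln (real n) \<le> half_norm2 k (\<omega> n)}" for n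
    have [measurable]: "A n \<in> sets (gauss_seq k)" for n unfolding A_def by measurable
    have a: "- (\<theta> * (1 + d / 2)) < - 1" using d by (simp add: \<theta>_def field_simps)
    have "summable (\<lambda>n. K * real n powr (- (\<theta> * (1 + d / 2))))"
      using a by (intro summable_mult) (simp add: summable_real_powr_iff)
    then have "summable (\<lambda>n. measure (gauss_seq k) (A n))"
    proof (rule summable_comparison_test_ev[rotated])
      show "\<forall>\<^sub>F n in sequentially. norm (measure (gauss_seq k) (A n)) \<le> K * real n powr (- (\<theta> * (1 + d / 2)))"
        using eventually_gt_at_top[of 0]
      proof eventually_elim
        case (elim n)
        then show ?case using K[of "(1 + d / 2) * ln (real n)" n]
          by (simp add: A_def powr_def algebra_simps)
      qed
    qed
    from borel_cantelli_AE1[OF _ _ this]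
    have "AE \<omega> in gauss_seq k. \<forall>\<^sub>F n in sequentially. \<omega> \<in> space (gauss_seq k) - A n"
      by (simp add: S.emeasure_eq_measure)
    then show ?thesis
      by eventually_elim (auto simp: A_def not_le elim!: eventually_mono)
  qed
  have "AE \<omega> in gauss_seq k. \<forall>m. \<forall>\<^sub>F n in sequentially. half_norm2 k (\<omega> n) < (1 + (1 / real (Suc m)) / 2) * ln (real n)"
    unfolding AE_all_countable by (intro allI bound) simp
  then show ?thesis
  proof eventually_elim
    case (elim \<omega>)
    show ?case
    proof (intro allI impI)
      fix d :: real assume "0 < d"
      then obtain m where m: "1 / real (Suc m) < d" using nat_approx_posE by metis
      show "\<forall>\<^sub>F n in sequentially. (\<Sum>j<k. (\<omega> n j)\<^sup>2) / ln (real n) < 2 + d"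
        using elim[rule_format, of m] eventually_gt_at_top[of 1]
      proof eventually_elim
        case (elim n)
        then have ln: "0 < ln (real n)" by simp
        have "(\<Sum>j<k. (\<omega> n j)\<^sup>2) < (2 + 1 / real (Suc m)) * ln (real n)"
          using elim(1) by (simp add: half_norm2_def field_simps del: of_nat_Suc)
        also have "\<dots> \<le> (2 + d) * ln (real n)" using m ln by (intro mult_right_mono) auto
        finally show ?case using ln by (simp add: pos_divide_less_eq)
      qed
    qed
  qed
qed

text \<open>The second Borel-Cantelli lemma for the independent coordinates of the product: avoiding
  \<open>S n\<close> for \<open>n = m..N\<close> has probability at most the exponential of minus
  the sum of the \<open>p n\<close>.\<close>

lemma AE_gauss_seq_frequently:
  assumes S [measurable]: "\<And>n. S n \<in> sets (gauss_vec k)"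
    and div: "\<not> summable (\<lambda>n. measure (gauss_vec k) (S n))"
  shows "AE \<omega> in gauss_seq k. \<exists>\<^sub>F n in sequentially. \<omega> n \<in> S n"
proof -
  interpret G: prob_space "gauss_seq k" by (rule prob_space_gauss_seq)
  interpret V: prob_space "gauss_vec k" by (rule prob_space_gauss_vec)
  define p where "p n = measure (gauss_vec k) (S n)" for n
  have p: "0 \<le> p n" "p n \<le> 1" for n by (auto simp: p_def)
  have "AE \<omega> in gauss_seq k. \<not> (\<forall>n\<ge>m. \<omega> n \<notin> S n)" for m
  proof -
    define A where "A = {\<omega> \<in> space (gauss_seq k). \<forall>n\<ge>m. \<omega> n \<notin> S n}"
    have [measurable]: "A \<in> sets (gauss_seq k)" unfolding A_def by measurable
    have le: "measure (gauss_seq k) A \<le> exp (- B)" for B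
    proof -
      \<comment> \<open>The first \<open>m\<close> probabilities add up to at most \<open>m\<close>,
        so the sum from \<open>m\<close> to \<open>N\<close> still exceeds \<open>B\<close>.\<close>
      have "\<exists>N. B + real m < (\<Sum>n\<le>N. p n)"
      proof (rule ccontr)
        assume "\<not> ?thesis"
        then have "summable p" by (intro bounded_imp_summable[of p "B + real m"]) (auto simp: p not_less)
        then show False using div by (simp add: p_def[abs_def])
      qed
      then obtain N where N: "B + real m < (\<Sum>n\<le>N. p n)" by blast
      have "(\<Sum>n\<le>N. p n) \<le> (\<Sum>n\<in>{..<m} \<union> {m..N}. p n)"
        by (rule sum_mono2) (use p in auto)
      also have "\<dots> = (\<Sum>n<m. p n) + (\<Sum>n=m..N. p n)" by (rule sum.union_disjoint) auto
      also have "(\<Sum>n<m. p n) \<le> real m" using sum_mono[of "{..<m}" p "\<lambda>_. 1"] p by simp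
      finally have B: "B < (\<Sum>n=m..N. p n)" using N by simp
      have "ennreal (measure (gauss_seq k) A) = (\<integral>\<^sup>+\<omega>. indicator A \<omega> \<partial>gauss_seq k)"
        by (simp add: G.emeasure_eq_measure)
      also have "\<dots> \<le> (\<integral>\<^sup>+\<omega>. (\<Prod>n\<in>{m..N}. indicator (space (gauss_vec k) - S n) (\<omega> n)) \<partial>gauss_seq k)"
      proof (rule nn_integral_mono)
        fix \<omega> assume "\<omega> \<in> space (gauss_seq k)"
        then have "\<omega> n \<in> space (gauss_vec k)" for n by (auto simp: space_PiM)
        then show "indicator A \<omega> \<le> (\<Prod>n\<in>{m..N}. indicator (space (gauss_vec k) - S n) (\<omega> n) :: ennreal)"
          by (cases "\<omega> \<in> A") (auto simp: A_def)
      qed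
      also have "\<dots> = (\<Prod>n\<in>{m..N}. \<integral>\<^sup>+x. indicator (space (gauss_vec k) - S n) x \<partial>gauss_vec k)"
        by (rule nn_integral_gauss_seq_prod) auto
      also have "\<dots> = (\<Prod>n\<in>{m..N}. ennreal (1 - p n))"
        by (intro prod.cong) (auto simp: V.emeasure_eq_measure V.prob_compl p_def)
      also have "\<dots> = ennreal (\<Prod>n\<in>{m..N}. 1 - p n)"
        by (rule prod_ennreal) (use p in auto)
      finally have "measure (gauss_seq k) A \<le> (\<Prod>n\<in>{m..N}. 1 - p n)"
        using p by (simp add: prod_nonneg)
      also have "\<dots> \<le> (\<Prod>n\<in>{m..N}. exp (- p n))"
      proof (rule prod_mono)
        fix n show "0 \<le> 1 - p n \<and> 1 - p n \<le> exp (- p n)"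
          using p[of n] exp_ge_add_one_self[of "- p n"] by simp
      qed
      also have "\<dots> = exp (- (\<Sum>n=m..N. p n))" by (simp add: exp_sum[symmetric] sum_negf)
      also have "\<dots> \<le> exp (- B)" using B by simp
      finally show ?thesis .
    qed
    have "measure (gauss_seq k) A = 0"
    proof (rule ccontr)
      assume "measure (gauss_seq k) A \<noteq> 0"
      then have pos: "0 < measure (gauss_seq k) A" by (simp add: zero_less_measure_iff)
      \<comment> \<open>Here \<open>B\<close> is chosen so that \<open>exp (- B)\<close> is half the
        measure of \<open>A\<close>.\<close>
      then have "measure (gauss_seq k) A \<le> measure (gauss_seq k) A / 2"
        using le[of "- ln (measure (gauss_seq k) A / 2)"] by simp
      then show False using pos by simp
    qed
    then have "A \<in> null_sets (gauss_seq k)" by (simp add: null_sets_def G.emeasure_eq_measure)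
    then show ?thesis by (rule AE_I') (auto simp: A_def)
  qed
  then have "AE \<omega> in gauss_seq k. \<forall>m. \<not> (\<forall>n\<ge>m. \<omega> n \<notin> S n)"
    unfolding AE_all_countable by simp
  then show ?thesis
    by eventually_elim (auto simp: frequently_def eventually_sequentially)
qed

text \<open>The box has volume 1, and on it the coordinates are at most
  \<open>\<bar>y j\<bar> + 1\<close> in absolute value, which bounds the density from below.\<close>

lemma measure_gauss_vec_box_ge:
  "(\<Prod>j<k. exp (- (\<bar>y j\<bar> + 1)\<^sup>2 / 2) / sqrt (2 * pi))
    \<le> measure (gauss_vec k) {x \<in> space (gauss_vec k). \<forall>j<k. y j \<le> x j \<and> x j \<le> y j + 1}"
proof -
  interpret V: prob_space "gauss_vec k" by (rule prob_space_gauss_vec)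
  let ?S = "{x \<in> space (gauss_vec k). \<forall>j<k. y j \<le> x j \<and> x j \<le> y j + 1}"
  have [measurable]: "?S \<in> sets (gauss_vec k)" by measurable
  have one: "ennreal (exp (- (\<bar>a\<bar> + 1)\<^sup>2 / 2) / sqrt (2 * pi)) \<le> emeasure std_gauss {a..a + 1}" for a :: real
  proof -
    have "ennreal (exp (- (\<bar>a\<bar> + 1)\<^sup>2 / 2) / sqrt (2 * pi))
        = (\<integral>\<^sup>+x. ennreal (exp (- (\<bar>a\<bar> + 1)\<^sup>2 / 2) / sqrt (2 * pi)) * indicator {a..a + 1} x \<partial>lborel)"
      by (subst nn_integral_cmult_indicator) auto
    also have "\<dots> \<le> (\<integral>\<^sup>+x. ennreal (std_normal_density x) * indicator {a..a + 1} x \<partial>lborel)"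
    proof (rule nn_integral_mono)
      fix x :: real
      have "exp (- (\<bar>a\<bar> + 1)\<^sup>2 / 2) / sqrt (2 * pi) \<le> std_normal_density x" if "a \<le> x" "x \<le> a + 1"
      proof -
        have "\<bar>x\<bar> \<le> \<bar>a\<bar> + 1" using that by linarith
        then have "x\<^sup>2 \<le> (\<bar>a\<bar> + 1)\<^sup>2" using abs_le_square_iff[of x "\<bar>a\<bar> + 1"] by simp
        then show ?thesis by (simp add: std_normal_density_def divide_right_mono)
      qed
      then show "ennreal (exp (- (\<bar>a\<bar> + 1)\<^sup>2 / 2) / sqrt (2 * pi)) * indicator {a..a + 1} x
          \<le> ennreal (std_normal_density x) * indicator {a..a + 1} x"
        by (auto simp: indicator_def intro!: ennreal_leI)
    qed
    also have "\<dots> = emeasure std_gauss {a..a + 1}"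
      by (subst emeasure_density) auto
    finally show ?thesis .
  qed
  have "ennreal (\<Prod>j<k. exp (- (\<bar>y j\<bar> + 1)\<^sup>2 / 2) / sqrt (2 * pi))
      = (\<Prod>j<k. ennreal (exp (- (\<bar>y j\<bar> + 1)\<^sup>2 / 2) / sqrt (2 * pi)))"
    by (rule prod_ennreal[symmetric]) simp
  also have "\<dots> \<le> (\<Prod>j<k. emeasure std_gauss {y j..y j + 1})"
    by (rule prod_mono_ennreal) (rule one)
  also have "\<dots> = (\<Prod>j<k. \<integral>\<^sup>+x. indicator {y j..y j + 1} x \<partial>std_gauss)" by simp
  also have "\<dots> = (\<integral>\<^sup>+x. (\<Prod>j<k. indicator {y j..y j + 1} (x j)) \<partial>gauss_vec k)"
    by (rule nn_integral_gauss_vec_prod[symmetric]) auto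
  also have "\<dots> = (\<integral>\<^sup>+x. indicator ?S x \<partial>gauss_vec k)"
  proof (rule nn_integral_cong)
    fix x assume x: "x \<in> space (gauss_vec k)"
    show "(\<Prod>j<k. indicator {y j..y j + 1} (x j)) = (indicator ?S x :: ennreal)"
    proof (cases "x \<in> ?S")
      case False
      then obtain j where "j < k" "x j \<notin> {y j..y j + 1}" using x by auto
      then have "(\<Prod>j<k. indicator {y j..y j + 1} (x j)) = (0 :: ennreal)"
        by (intro prod_zero) (auto intro!: bexI[of _ j])
      moreover have "indicator ?S x = (0 :: ennreal)" using False by (rule indicator_simps(2))
      ultimately show ?thesis by simp
    qed auto
  qed
  also have "\<dots> = ennreal (measure (gauss_vec k) ?S)" by (simp add: V.emeasure_eq_measure)
  finally show ?thesis by (simp add: measure_nonneg)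
qed

text \<open>A unit box with corner \<open>c * sqrt (ln n) * e\<close> shrinks to the point
  \<open>c * e\<close> after division by \<open>sqrt (ln n)\<close>. Its Gaussian mass is
  \<open>n\<close> to the power \<open>- c\<^sup>2 / 2\<close> up to a factor
  \<open>exp (O (sqrt (ln n)))\<close>, and \<open>c\<^sup>2 / 2\<close> below 1 makes it eventually
  larger than \<open>1 / n\<close>, so the masses have a divergent sum.\<close>

lemma AE_gauss_seq_cluster:
  assumes e: "(\<Sum>j<k. (e j)\<^sup>2) = 1" and c: "c\<^sup>2 < 2"
  shows "AE \<omega> in gauss_seq k. \<forall>d>0. \<exists>\<^sub>F n in sequentially.
    \<bar>(\<Sum>j<k. \<omega> n j / sqrt (ln (real n)) * e j) - c\<bar> < d \<and>
    \<bar>(\<Sum>j<k. (\<omega> n j)\<^sup>2) / ln (real n) - c\<^sup>2\<bar> < d"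
proof -
  define y where "y n j = c * e j * sqrt (ln (real n))" for n j
  define S where "S n = {x \<in> space (gauss_vec k). \<forall>j<k. y n j \<le> x j \<and> x j \<le> y n j + 1}" for n
  \<comment> \<open>\<open>D\<close> is the coefficient of \<open>sqrt (ln n)\<close> in the sum of
    the \<open>(\<bar>y n j\<bar> + 1)\<^sup>2 / 2\<close>; \<open>K\<close> collects the constants,
    including the normalisation of the density.\<close>
  define D where "D = (\<Sum>j<k. \<bar>c * e j\<bar>)"
  define K where "K = real k / 2 + real k * ln (sqrt (2 * pi))"
  have D: "0 \<le> D" unfolding D_def by (intro sum_nonneg) simp
  have "1 \<le> sqrt (2 * pi)" using pi_gt3 by (subst real_sqrt_ge_1_iff) linarith
  then have K: "0 \<le> K" by (simp add: K_def)
  define \<gamma> where "\<gamma> = 1 - c\<^sup>2 / 2"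
  have \<gamma>: "0 < \<gamma>" using c by (simp add: \<gamma>_def)
  have lnx: "filterlim (\<lambda>n. sqrt (ln (real n))) at_top sequentially"
    by (intro filterlim_compose[OF sqrt_at_top] filterlim_compose[OF ln_at_top] filterlim_real_sequentially)
  \<comment> \<open>Beyond the threshold \<open>(D + K) / \<gamma>\<close> the spare term
    \<open>\<gamma> * x\<^sup>2\<close> absorbs \<open>D * x + K\<close>, where
    \<open>x = sqrt (ln n)\<close>.\<close>
  have lower: "\<forall>\<^sub>F n in sequentially. 1 / real n \<le> measure (gauss_vec k) (S n)"
    using eventually_gt_at_top[of 0] filterlim_at_top[THEN iffD1, OF lnx, rule_format, of "max 1 ((D + K) / \<gamma>)"]
  proof eventually_elim
    case (elim n)
    define x where "x = sqrt (ln (real n))"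
    have x: "1 \<le> x" "(D + K) / \<gamma> \<le> x" using elim(2) by (auto simp: x_def)
    have x2: "x\<^sup>2 = ln (real n)" using elim(1) by (simp add: x_def)
    have "D + K \<le> \<gamma> * x" using x(2) \<gamma> by (simp add: pos_divide_le_eq mult.commute)
    then have "(D + K) * x \<le> \<gamma> * x * x" using x(1) by (intro mult_right_mono) auto
    moreover have "K * 1 \<le> K * x" using x(1) K by (intro mult_left_mono)
    ultimately have main: "c\<^sup>2 / 2 * x\<^sup>2 + D * x + K \<le> ln (real n)"
      unfolding x2[symmetric] by (simp add: \<gamma>_def power2_eq_square algebra_simps)
    have "(\<Sum>j<k. (\<bar>y n j\<bar> + 1)\<^sup>2) = (\<Sum>j<k. c\<^sup>2 * x\<^sup>2 * (e j)\<^sup>2 + 2 * x * \<bar>c * e j\<bar> + 1)"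
      using x(1) unfolding y_def x_def[symmetric]
      by (intro sum.cong) (auto simp: power2_eq_square abs_mult algebra_simps)
    also have "\<dots> = c\<^sup>2 * x\<^sup>2 + 2 * x * D + real k"
      by (simp add: sum.distrib sum_distrib_left[symmetric] e D_def)
    finally have ssum: "(\<Sum>j<k. (\<bar>y n j\<bar> + 1)\<^sup>2) = c\<^sup>2 * x\<^sup>2 + 2 * x * D + real k" .
    have "1 / real n = exp (- ln (real n))" using elim(1) by (simp add: exp_minus inverse_eq_divide)
    also have "\<dots> \<le> exp (- (c\<^sup>2 / 2 * x\<^sup>2 + D * x + K))" using main by simp
    also have "\<dots> = (\<Prod>j<k. exp (- (\<bar>y n j\<bar> + 1)\<^sup>2 / 2) / sqrt (2 * pi))"
    proof -
      have "(\<Prod>j<k. exp (- (\<bar>y n j\<bar> + 1)\<^sup>2 / 2) / sqrt (2 * pi))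
          = (\<Prod>j<k. exp (- (\<bar>y n j\<bar> + 1)\<^sup>2 / 2 - ln (sqrt (2 * pi))))"
        by (simp add: exp_diff)
      also have "\<dots> = exp (\<Sum>j<k. - (\<bar>y n j\<bar> + 1)\<^sup>2 / 2 - ln (sqrt (2 * pi)))"
        by (simp only: exp_sum finite_lessThan)
      also have "(\<Sum>j<k. - (\<bar>y n j\<bar> + 1)\<^sup>2 / 2 - ln (sqrt (2 * pi)))
          = - (\<Sum>j<k. (\<bar>y n j\<bar> + 1)\<^sup>2) / 2 - real k * ln (sqrt (2 * pi))"
        by (simp only: sum_subtractf sum_constant card_lessThan sum_divide_distrib[symmetric] sum_negf)
      finally show ?thesis unfolding ssum K_def by (simp add: field_simps)
    qed
    also have "\<dots> \<le> measure (gauss_vec k) (S n)"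
      unfolding S_def by (rule measure_gauss_vec_box_ge)
    finally show ?case .
  qed
  have "AE \<omega> in gauss_seq k. \<exists>\<^sub>F n in sequentially. \<omega> n \<in> S n"
  proof (rule AE_gauss_seq_frequently)
    show "S n \<in> sets (gauss_vec k)" for n unfolding S_def by measurable
    show "\<not> summable (\<lambda>n. measure (gauss_vec k) (S n))"
    proof
      assume "summable (\<lambda>n. measure (gauss_vec k) (S n))"
      then have "summable (\<lambda>n. 1 / real n)"
        by (rule summable_comparison_test_ev[rotated]) (use lower in \<open>auto elim!: eventually_mono\<close>)
      then show False using not_summable_harmonic[where 'a = real] by (simp add: inverse_eq_divide)
    qed
  qed
  then show ?thesis
  proof eventually_elim
    case (elim \<omega>)
    show ?case
    proof (intro allI impI)
      fix d :: real assume d: "0 < d"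
      \<comment> \<open>In the difference of squares the factor
        \<open>\<omega> n j / x - c * e j\<close> is at most \<open>1 / x\<close> and the factor
        \<open>\<omega> n j / x + c * e j\<close> at most \<open>1 + 2 * 2 = 5\<close> in absolute
        value. The extra 1 ensures that \<open>x\<close> is at least 1.\<close>
      define B where "B = real k * 5 / d + 1"
      have "\<forall>\<^sub>F n in sequentially. B \<le> sqrt (ln (real n)) \<and> 0 < n"
        using filterlim_at_top[THEN iffD1, OF lnx] eventually_gt_at_top[of 0] by (auto intro: eventually_conj)
      with elim show "\<exists>\<^sub>F n in sequentially.
        \<bar>(\<Sum>j<k. \<omega> n j / sqrt (ln (real n)) * e j) - c\<bar> < d \<and>
        \<bar>(\<Sum>j<k. (\<omega> n j)\<^sup>2) / ln (real n) - c\<^sup>2\<bar> < d"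
      proof (rule frequently_rev_mp[OF _ eventually_mono])
        fix n assume n: "B \<le> sqrt (ln (real n)) \<and> 0 < n"
        define x where "x = sqrt (ln (real n))"
        have x: "1 \<le> x" "real k * 5 / x < d"
        proof -
          have "0 \<le> real k * 5 / d" using d by simp
          moreover have "B \<le> x" using n unfolding x_def by (rule conjunct1)
          ultimately have x1: "1 \<le> x" "real k * 5 / d < x" by (simp_all add: B_def)
          then show "1 \<le> x" by simp
          show "real k * 5 / x < d" using d x1 by (simp add: pos_divide_less_eq mult.commute)
        qed
        have x2: "x\<^sup>2 = ln (real n)" using n by (simp add: x_def)
        show "\<omega> n \<in> S n \<longrightarrow> \<bar>(\<Sum>j<k. \<omega> n j / sqrt (ln (real n)) * e j) - c\<bar> < d \<and>
          \<bar>(\<Sum>j<k. (\<omega> n j)\<^sup>2) / ln (real n) - c\<^sup>2\<bar> < d"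
        proof
          assume "\<omega> n \<in> S n"
          then have S: "c * e j * x \<le> \<omega> n j" "\<omega> n j \<le> c * e j * x + 1" if "j < k" for j
            using that by (auto simp: S_def y_def x_def)
          have w: "\<bar>\<omega> n j / x - c * e j\<bar> \<le> 1 / x" if "j < k" for j
          proof -
            have "\<omega> n j / x - c * e j = (\<omega> n j - c * e j * x) / x" using x by (simp add: diff_divide_distrib)
            moreover have "\<bar>\<omega> n j - c * e j * x\<bar> \<le> 1" using S[OF that] by (simp add: abs_le_iff)
            ultimately show ?thesis using x by (simp add: divide_right_mono)
          qed
          have e1: "\<bar>e j\<bar> \<le> 1" if "j < k" for j
          proof -
            have "(e j)\<^sup>2 \<le> (\<Sum>j<k. (e j)\<^sup>2)" by (rule member_le_sum) (use that in auto)
            then show ?thesis using e by (simp add: abs_square_le_1)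
          qed
          have c2: "\<bar>c\<bar> \<le> 2" using c abs_le_square_iff[of c 2] by simp
          have kx: "real k * (1 / x) \<le> real k * 5 / x" using x by (simp add: divide_right_mono)
          have "(\<Sum>j<k. \<omega> n j / x * e j) - c = (\<Sum>j<k. (\<omega> n j / x - c * e j) * e j)"
          proof -
            have "c = (\<Sum>j<k. c * e j * e j)"
              using e by (simp add: mult.assoc sum_distrib_left[symmetric] power2_eq_square)
            then show ?thesis by (simp add: left_diff_distrib sum_subtractf)
          qed
          also have "\<bar>\<dots>\<bar> \<le> (\<Sum>j<k. 1 / x)"
          proof (rule order_trans[OF sum_abs sum_mono])
            fix j assume "j \<in> {..<k}"
            then have "\<bar>\<omega> n j / x - c * e j\<bar> * \<bar>e j\<bar> \<le> 1 / x * 1"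
              using w e1 x by (intro mult_mono) auto
            then show "\<bar>(\<omega> n j / x - c * e j) * e j\<bar> \<le> 1 / x" by (simp add: abs_mult)
          qed
          finally have 1: "\<bar>(\<Sum>j<k. \<omega> n j / x * e j) - c\<bar> < d" using kx x(2) by simp
          have "(\<Sum>j<k. (\<omega> n j)\<^sup>2) / ln (real n) - c\<^sup>2
              = (\<Sum>j<k. (\<omega> n j / x - c * e j) * (\<omega> n j / x + c * e j))"
          proof -
            have "(\<Sum>j<k. (\<omega> n j / x - c * e j) * (\<omega> n j / x + c * e j))
                = (\<Sum>j<k. (\<omega> n j)\<^sup>2 / x\<^sup>2 - c\<^sup>2 * (e j)\<^sup>2)"
              by (intro sum.cong) (auto simp: power2_eq_square algebra_simps)
            also have "\<dots> = (\<Sum>j<k. (\<omega> n j)\<^sup>2) / x\<^sup>2 - c\<^sup>2"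
              by (simp add: sum_subtractf sum_divide_distrib[symmetric] sum_distrib_left[symmetric] e)
            finally show ?thesis by (simp add: x2)
          qed
          also have "\<bar>\<dots>\<bar> \<le> (\<Sum>j<k. 1 / x * 5)"
          proof (rule order_trans[OF sum_abs sum_mono])
            fix j assume "j \<in> {..<k}"
            then have j: "j < k" by simp
            have "\<bar>c * e j\<bar> \<le> 2 * 1" unfolding abs_mult by (rule mult_mono) (use c2 e1[OF j] in auto)
            moreover have "1 / x \<le> 1" using x by simp
            ultimately have "\<bar>\<omega> n j / x + c * e j\<bar> \<le> 5" using w[OF j] by linarith
            then have "\<bar>\<omega> n j / x - c * e j\<bar> * \<bar>\<omega> n j / x + c * e j\<bar> \<le> 1 / x * 5"
              using w[OF j] x by (intro mult_mono) auto
            then show "\<bar>(\<omega> n j / x - c * e j) * (\<omega> n j / x + c * e j)\<bar> \<le> 1 / x * 5" by (simp add: abs_mult)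
          qed
          finally have 2: "\<bar>(\<Sum>j<k. (\<omega> n j)\<^sup>2) / ln (real n) - c\<^sup>2\<bar> < d" using x(2) by simp
          show "\<bar>(\<Sum>j<k. \<omega> n j / sqrt (ln (real n)) * e j) - c\<bar> < d \<and>
            \<bar>(\<Sum>j<k. (\<omega> n j)\<^sup>2) / ln (real n) - c\<^sup>2\<bar> < d"
            using 1 2 by (simp add: x_def)
        qed
      qed
    qed
  qed
qed

text \<open>For fixed \<open>z\<close>, expanding the square gives \<open>sqrt l\<close> times the
  inner product of \<open>\<xi>\<close> and \<open>z\<close>, plus
  \<open>l * \<bar>\<xi>\<bar>\<^sup>2 / 2\<close>; after division this is the \<open>q\<close> of
  the locale. With \<open>x0 = \<rho>\<^sup>2 / 2\<close> and \<open>b = sqrt \<beta>\<close>, the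
  two cases for the lower limit are those of the position of the vertex.\<close>

lemma AE_gauss_seq_limits:
  fixes l z :: "nat \<Rightarrow> real"
  assumes k: "1 \<le> k" and l: "\<And>n. 2 \<le> n \<Longrightarrow> 0 < l n"
    and lim: "(\<lambda>n. l n * ln (real n)) \<longlonglongrightarrow> \<beta>"
  defines "x0 \<equiv> half_norm2 k z"
    and "Q \<equiv> \<lambda>\<omega> n. (half_norm2 k (\<lambda>j. sqrt (l n) * \<omega> n j + z j) - half_norm2 k z) / sqrt (l n * ln (real n))"
  shows "AE \<omega> in gauss_seq k.
    limsup (\<lambda>n. ereal \<bar>Q \<omega> n\<bar>) = ereal (sqrt \<beta> + 2 * sqrt x0) \<and>
    limsup (\<lambda>n. ereal (Q \<omega> n)) = ereal (sqrt \<beta> + 2 * sqrt x0) \<and>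
    liminf (\<lambda>n. ereal (Q \<omega> n)) = ereal (if x0 < \<beta> then - x0 / sqrt \<beta> else sqrt \<beta> - 2 * sqrt x0)"
proof -
  define \<rho> where "\<rho> = sqrt (\<Sum>j<k. (z j)\<^sup>2)"
  have rho: "0 \<le> \<rho>" "\<rho>\<^sup>2 = (\<Sum>j<k. (z j)\<^sup>2)" by (auto simp: \<rho>_def sum_nonneg)
  \<comment> \<open>The direction of \<open>z\<close>; if \<open>z\<close> vanishes on the first
    \<open>k\<close> coordinates, any unit vector serves, and one exists because \<open>k\<close> is
    positive.\<close>
  obtain e where e: "(\<Sum>j<k. (e j)\<^sup>2) = 1" "\<And>j. j < k \<Longrightarrow> z j = \<rho> * e j"
  proof (cases "\<rho> = 0")
    case True
    then have "\<forall>j\<in>{..<k}. (z j)\<^sup>2 = 0"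
      using rho(2) by (subst sum_nonneg_eq_0_iff[symmetric]) auto
    moreover have "(\<Sum>j<k. (if j = 0 then 1 else 0 :: real)\<^sup>2) = (\<Sum>j<k. if j = 0 then 1 else 0)"
      by (intro sum.cong) auto
    moreover have "\<dots> = 1" using k by simp
    ultimately show ?thesis using that[of "\<lambda>j. if j = 0 then 1 else 0"] True by auto
  next
    case False
    then have "(\<Sum>j<k. (z j)\<^sup>2) \<noteq> 0" unfolding rho(2)[symmetric] by simp
    then show ?thesis
      using False that[of "\<lambda>j. z j / \<rho>"] rho(2) by (simp add: power_divide sum_divide_distrib[symmetric])
  qed
  have b: "0 \<le> \<beta>"
    by (rule LIMSEQ_le_const[OF lim]) (use l in \<open>auto intro!: exI[of _ 2] intro: less_imp_le\<close>)
  have "AE \<omega> in gauss_seq k. \<forall>c\<in>{c\<in>\<rat>. c\<^sup>2 < 2}. \<forall>d>0. \<exists>\<^sub>F n in sequentially.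
    \<bar>(\<Sum>j<k. \<omega> n j / sqrt (ln (real n)) * e j) - c\<bar> < d \<and>
    \<bar>(\<Sum>j<k. (\<omega> n j)\<^sup>2) / ln (real n) - c\<^sup>2\<bar> < d"
  proof (subst AE_ball_countable)
    show "countable {c \<in> \<rat>. c\<^sup>2 < (2 :: real)}"
      by (rule countable_subset[OF _ countable_rat]) auto
  qed (use AE_gauss_seq_cluster[OF e(1)] in blast)
  then show ?thesis
    using AE_gauss_seq_norm_upper[of k]
  proof eventually_elim
    case (elim \<omega>)
    \<comment> \<open>Here \<open>\<rho>\<close> is the norm of \<open>z\<close>,
      \<open>r n = sqrt (l n * ln n)\<close> and \<open>Q \<omega>\<close> is the normalised
      increment.\<close>
    interpret cluster_limits "\<lambda>n. \<Sum>j<k. \<omega> n j / sqrt (ln (real n)) * e j"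
      "\<lambda>n. (\<Sum>j<k. (\<omega> n j)\<^sup>2) / ln (real n)" "\<lambda>n. sqrt (l n * ln (real n))" "Q \<omega>" "sqrt \<beta>" \<rho>
    proof
      fix n
      show "(\<Sum>j<k. \<omega> n j / sqrt (ln (real n)) * e j)\<^sup>2 \<le> (\<Sum>j<k. (\<omega> n j)\<^sup>2) / ln (real n)"
      proof (cases "n = 0")
        case False
        have "(\<Sum>j<k. \<omega> n j / sqrt (ln (real n)) * e j)\<^sup>2
            \<le> (\<Sum>j<k. (\<omega> n j / sqrt (ln (real n)))\<^sup>2) * (\<Sum>j<k. (e j)\<^sup>2)"
          by (rule Cauchy_Schwarz_ineq_sum)
        also have "\<dots> = (\<Sum>j<k. (\<omega> n j)\<^sup>2) / ln (real n)"
          using False by (simp add: e power_divide sum_divide_distrib)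
        finally show ?thesis .
      qed simp
      show "0 \<le> sqrt (l n * ln (real n))"
      proof (cases "n < 2")
        case True
        then have "n = 0 \<or> n = 1" by auto
        then show ?thesis by auto
      qed (use l[of n] in auto)
    next
      show "\<forall>\<^sub>F n in sequentially. Q \<omega> n = \<rho> * (\<Sum>j<k. \<omega> n j / sqrt (ln (real n)) * e j) +
        sqrt (l n * ln (real n)) * ((\<Sum>j<k. (\<omega> n j)\<^sup>2) / ln (real n)) / 2"
        using eventually_ge_at_top[of 2]
      proof eventually_elim
        case (elim n)
        define a where "a = sqrt (l n)"
        define x where "x = sqrt (ln (real n))"
        have a: "0 < a" "sqrt (l n) = a" using l[OF elim] by (auto simp: a_def)
        have x: "0 < x" "ln (real n) = x\<^sup>2" "sqrt (ln (real n)) = x" using elim by (auto simp: x_def)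
        have ax: "sqrt (l n * ln (real n)) = a * x" by (simp add: a_def x_def real_sqrt_mult)
        have "half_norm2 k (\<lambda>j. a * \<omega> n j + z j) - half_norm2 k z
            = (\<Sum>j<k. (a * \<omega> n j + z j)\<^sup>2 - (z j)\<^sup>2) / 2"
          by (simp add: half_norm2_def sum_subtractf diff_divide_distrib)
        also have "(\<Sum>j<k. (a * \<omega> n j + z j)\<^sup>2 - (z j)\<^sup>2) = (\<Sum>j<k. 2 * a * \<rho> * (\<omega> n j * e j) + a\<^sup>2 * (\<omega> n j)\<^sup>2)"
          by (intro sum.cong) (auto simp: e(2) power2_eq_square algebra_simps)
        also have "\<dots> = 2 * a * \<rho> * (\<Sum>j<k. \<omega> n j * e j) + a\<^sup>2 * (\<Sum>j<k. (\<omega> n j)\<^sup>2)"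
          by (simp add: sum.distrib sum_distrib_left)
        finally have diff: "half_norm2 k (\<lambda>j. a * \<omega> n j + z j) - half_norm2 k z
            = (2 * a * \<rho> * (\<Sum>j<k. \<omega> n j * e j) + a\<^sup>2 * (\<Sum>j<k. (\<omega> n j)\<^sup>2)) / 2" .
        have "Q \<omega> n = (2 * a * \<rho> * (\<Sum>j<k. \<omega> n j * e j) + a\<^sup>2 * (\<Sum>j<k. (\<omega> n j)\<^sup>2)) / 2 / (a * x)"
          unfolding Q_def ax a(2) diff ..
        also have "\<dots> = \<rho> * ((\<Sum>j<k. \<omega> n j * e j) / x) + a * x * ((\<Sum>j<k. (\<omega> n j)\<^sup>2) / x\<^sup>2) / 2"
          using a(1) x(1) by (simp add: field_simps power2_eq_square)
        also have "(\<Sum>j<k. \<omega> n j * e j) / x = (\<Sum>j<k. \<omega> n j / x * e j)"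
          by (simp add: sum_divide_distrib)
        finally show ?case unfolding ax x(3) by (simp add: x(2))
      qed
    qed (use elim rho(1) in \<open>auto intro!: tendsto_real_sqrt lim\<close>)
    have x0: "x0 = \<rho>\<^sup>2 / 2" by (simp add: x0_def half_norm2_def rho(2))
    have "2 * sqrt x0 = sqrt 2 * \<rho>"
    proof -
      have "sqrt x0 = \<rho> / sqrt 2" using rho(1) by (simp add: x0 real_sqrt_divide)
      then have "2 * sqrt x0 = 2 / sqrt 2 * \<rho>" by simp
      then show ?thesis by (simp only: real_div_sqrt[of 2, simplified])
    qed
    then show ?case
      using limsup_eq limsup_abs_eq liminf_eq_small liminf_eq_large b
      by (auto simp: x0 not_less)
  qed
qed

section \<open>Permanental sequences\<close>

lemma sets_Collect_limsup_liminf: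
  fixes q :: "nat \<Rightarrow> 'a \<Rightarrow> real" and a b c :: "'a \<Rightarrow> ereal"
  assumes [measurable]: "\<And>n. q n \<in> borel_measurable M" "a \<in> borel_measurable M" "b \<in> borel_measurable M" "c \<in> borel_measurable M"
  shows "{\<omega> \<in> space M. limsup (\<lambda>n. ereal \<bar>q n \<omega>\<bar>) = a \<omega> \<and> limsup (\<lambda>n. ereal (q n \<omega>)) = b \<omega> \<and>
    liminf (\<lambda>n. ereal (q n \<omega>)) = c \<omega>} \<in> sets M"
proof -
  have [measurable]: "(\<lambda>\<omega>. limsup (\<lambda>n. ereal \<bar>q n \<omega>\<bar>)) \<in> borel_measurable M"
    "(\<lambda>\<omega>. limsup (\<lambda>n. ereal (q n \<omega>))) \<in> borel_measurable M"
    "(\<lambda>\<omega>. liminf (\<lambda>n. ereal (q n \<omega>))) \<in> borel_measurable M"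
    by (rule borel_measurable_limsup borel_measurable_liminf, measurable)+
  show ?thesis by (intro sets.sets_Collect borel_measurable_eq) measurable
qed

theorem theorem1p5:
  fixes T :: "real set" and l f g :: "nat \<Rightarrow> real" and U :: "real \<Rightarrow> real \<Rightarrow> real"
    and \<beta> :: real and k :: nat and M :: "'a measure" and X :: "real \<Rightarrow> 'a \<Rightarrow> real"
  assumes T: "T = insert 0 {1 / real j | j. 2 \<le> j}"
    and l_pos: "\<And>j. 2 \<le> j \<Longrightarrow> 0 < l j"
    and f_bounds: "\<And>j. 2 \<le> j \<Longrightarrow> 0 < f j \<and> f j < 1"
    and g_bounds: "\<And>j. 2 \<le> j \<Longrightarrow> 0 < g j \<and> g j < 1"
    and l_lim: "l \<longlonglongrightarrow> 0"
    and f_summable: "summable (\<lambda>j. (1 - f (j + 2)) / l (j + 2))"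
    and f_sum: "(\<Sum>j. (1 - f (j + 2)) / l (j + 2)) < 1"
    and g_summable: "summable (\<lambda>j. (1 - g (j + 2)) / l (j + 2))"
    and g_sum: "(\<Sum>j. (1 - g (j + 2)) / l (j + 2)) < 1"
    and U_00: "U 0 0 = 2"
    and U_0j: "\<And>j. 2 \<le> j \<Longrightarrow> U 0 (1 / real j) = 1 + g j"
    and U_i0: "\<And>i. 2 \<le> i \<Longrightarrow> U (1 / real i) 0 = 1 + f i"
    and U_ij: "\<And>i j. 2 \<le> i \<Longrightarrow> 2 \<le> j \<Longrightarrow>
      U (1 / real i) (1 / real j) = l i * (if i = j then 1 else 0) + 1 + f i * g j"
    and l_log_lim: "(\<lambda>n. l n * ln (real n)) \<longlonglongrightarrow> \<beta>"
    and \<beta>_nonneg: "0 \<le> \<beta>"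
    and k: "1 \<le> k"
    and M: "prob_space M"
    and X: "prob_space.permanental_process M (real k / 2) T U X"
  shows "AE \<omega> in M.
      limsup (\<lambda>n. ereal (\<bar>X (1 / real n) \<omega> - X 0 \<omega>\<bar> / sqrt (l n * ln (real n))))
        = ereal (sqrt \<beta> + 2 * sqrt (X 0 \<omega>)) \<and>
      limsup (\<lambda>n. ereal ((X (1 / real n) \<omega> - X 0 \<omega>) / sqrt (l n * ln (real n))))
        = ereal (sqrt \<beta> + 2 * sqrt (X 0 \<omega>)) \<and>
      liminf (\<lambda>n. ereal ((X (1 / real n) \<omega> - X 0 \<omega>) / sqrt (l n * ln (real n))))
        = ereal (if X 0 \<omega> < \<beta> then - X 0 \<omega> / sqrt \<beta>
                 else sqrt \<beta> - 2 * sqrt (X 0 \<omega>))"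
proof -
  interpret M: prob_space M by (rule M)
  define \<alpha> where "\<alpha> = real k / 2"
  have \<alpha>: "0 < \<alpha>" using k by (simp add: \<alpha>_def)
  define lims where "lims x q \<longleftrightarrow>
      limsup (\<lambda>n. ereal \<bar>q n\<bar>) = ereal (sqrt \<beta> + 2 * sqrt x) \<and>
      limsup (\<lambda>n. ereal (q n)) = ereal (sqrt \<beta> + 2 * sqrt x) \<and>
      liminf (\<lambda>n. ereal (q n)) = ereal (if x < \<beta> then - x / sqrt \<beta> else sqrt \<beta> - 2 * sqrt x)"
    for x and q :: "nat \<Rightarrow> real"
  \<comment> \<open>Invariance under shifts lets one and the same event \<open>A\<close> be read off
    the coordinates beyond any \<open>m\<close>.\<close>
  have lims_shift: "lims x (\<lambda>n. q (n + N)) \<longleftrightarrow> lims x q" for x q N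
    using limsup_shift_k[of "\<lambda>n. ereal \<bar>q n\<bar>" N] limsup_shift_k[of "\<lambda>n. ereal (q n)" N]
      liminf_shift_k[of "\<lambda>n. ereal (q n)" N]
    by (simp add: lims_def)
  define qX where "qX \<omega> n = (X (1 / real n) \<omega> - X 0 \<omega>) / sqrt (l n * ln (real n))" for \<omega> n
  define A where "A = {\<omega> \<in> space M. lims (X 0 \<omega>) (qX \<omega>)}"
  define hf where "hf j = (1 - f (j + 2)) / l (j + 2)" for j
  define hg where "hg j = (1 - g (j + 2)) / l (j + 2)" for j
  have hf: "summable hf" "0 \<le> hf j" and hg: "summable hg" "0 \<le> hg j" for j
    using f_summable g_summable l_pos[of "j + 2"] f_bounds[of "j + 2"] g_bounds[of "j + 2"]
    by (auto simp: hf_def[abs_def] hg_def[abs_def] intro!: divide_nonneg_pos)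
  \<comment> \<open>The term \<open>hf (j + m)\<close> belongs to the index
    \<open>j + m + 2\<close>, so \<open>\<delta> m\<close> covers the indices beyond
    \<open>Suc m\<close>.\<close>
  define \<delta> where "\<delta> m = max (\<Sum>j. hf (j + m)) (\<Sum>j. hg (j + m))" for m
  have \<delta>_lim: "\<delta> \<longlonglongrightarrow> 0"
    using tendsto_max[OF suminf_exist_split2[OF hf(1)] suminf_exist_split2[OF hg(1)]]
    by (simp add: \<delta>_def[abs_def])
  define \<epsilon> where "\<epsilon> m = (1 - 10 * \<delta> m) powr (- \<alpha>) - 1" for m
  have \<epsilon>_lim: "\<epsilon> \<longlonglongrightarrow> 0"
  proof -
    have "(\<lambda>m. (1 - 10 * \<delta> m) powr (- \<alpha>) - 1) \<longlonglongrightarrow> (1 - 10 * 0) powr (- \<alpha>) - 1"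
      by (intro tendsto_intros \<delta>_lim) simp
    then show ?thesis by (simp add: \<epsilon>_def[abs_def])
  qed
  \<comment> \<open>The event has probability one in the Gaussian model, so a one-sided comparison
    suffices. The bound \<open>1 / 10\<close> keeps \<open>10 * \<delta> m\<close> inside the
    interval of convergence of the binomial series.\<close>
  have main: "A \<in> sets M \<and> 1 \<le> measure M A + \<epsilon> m" if \<delta>m: "\<delta> m < 1 / 10" for m
  proof -
    \<comment> \<open>The point \<open>0\<close> of \<open>T\<close> is also addressed as \<open>1 / real 0\<close>.\<close>
    define h where "h i = (if i = 0 then 0 else Suc m + i)" for i
    define Y where "Y i = X (1 / real (h i))" for i
    \<comment> \<open>The values 0, 1, 1 of \<open>L\<close>, \<open>F\<close>, \<open>G\<close> at
      position 0 make the single formula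
      \<open>L i * (if i = j then 1 else 0) + 1 + F i * G j\<close> reproduce the row and column of
      the point 0, including \<open>U 0 0 = 2\<close>.\<close>
    define L where "L i = (if i = 0 then 0 else l (Suc m + i))" for i
    define F where "F i = (if i = 0 then 1 else f (Suc m + i))" for i
    define G where "G i = (if i = 0 then 1 else g (Suc m + i))" for i
    have L: "L 0 = 0" "0 < i \<Longrightarrow> 0 < L i" for i using l_pos by (auto simp: L_def)
    have L_nonneg: "0 \<le> L i" for i using L(1) L(2)[of i] by (cases "i = 0") auto
    have F: "F 0 = 1" "0 \<le> F i \<and> F i \<le> 1" for i
      using f_bounds[of "Suc m + i"] by (auto simp: F_def)
    have G: "G 0 = 1" "0 \<le> G i \<and> G i \<le> 1" for i
      using g_bounds[of "Suc m + i"] by (auto simp: G_def)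
    have U: "U (1 / real (h i)) (1 / real (h j)) = L i * (if i = j then 1 else 0) + 1 + F i * G j" for i j
      using U_00 U_0j[of "h j"] U_i0[of "h i"] U_ij[of "h i" "h j"]
      by (cases "i = 0"; cases "j = 0") (auto simp: h_def L_def F_def G_def)
    have vec: "M.permanental_vector \<alpha> n
        (Matrix.mat n n (\<lambda>(i, j). L i * (if i = j then 1 else 0) + 1 + F i * G j)) Y" if "1 \<le> n" for n
    proof -
      have "inj_on (\<lambda>i. 1 / real (h i)) {..<n}"
        by (auto simp: inj_on_def h_def split: if_splits)
      moreover have "(\<lambda>i. 1 / real (h i)) ` {..<n} \<subseteq> T"
      proof (rule image_subsetI)
        fix i
        show "1 / real (h i) \<in> T"
        proof (cases "i = 0")
          case False
          then have "2 \<le> h i" by (simp add: h_def)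
          then show ?thesis unfolding T by blast
        qed (simp add: T h_def)
      qed
      ultimately have "M.permanental_vector (real k / 2) n
          (Matrix.mat n n (\<lambda>(i, j). U (1 / real (h i)) (1 / real (h j)))) (\<lambda>i. X (1 / real (h i)))"
        using X that unfolding M.permanental_process_def by blast
      then show ?thesis unfolding U \<alpha>_def Y_def[abs_def] .
    qed
    have Y [measurable]: "Y i \<in> borel_measurable M" and Y_nonneg: "\<omega> \<in> space M \<Longrightarrow> 0 \<le> Y i \<omega>" for i \<omega>
      using vec[of "Suc i"] by (auto simp: M.permanental_vector_def)
    let ?N = "gauss_vec k \<Otimes>\<^sub>M gauss_seq k"
    interpret V: prob_space "gauss_vec k" by (rule prob_space_gauss_vec)
    interpret S: prob_space "gauss_seq k" by (rule prob_space_gauss_seq)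
    interpret VS: pair_prob_space "gauss_vec k" "gauss_seq k" ..
    \<comment> \<open>For \<open>i > 0\<close> the noise index \<open>Suc m + i\<close> is also the
      index of \<open>l\<close>. Since \<open>L 0 = 0\<close>, the variable \<open>Z 0\<close>
      contains no noise and is half the squared norm of the common vector.\<close>
    define Z where "Z i \<omega> = half_norm2 k (\<lambda>j. sqrt (L i) * snd \<omega> (Suc m + i) j + sqrt 2 * fst \<omega> j)" for i \<omega>
    have [measurable]: "(\<lambda>\<omega>. snd \<omega> i j) \<in> borel_measurable ?N" if "j < k" for i j
      by (rule measurable_compose[OF measurable_snd measurable_gauss_seq_component[OF that]])
    have [measurable]: "(\<lambda>\<omega>. fst \<omega> j) \<in> borel_measurable ?N" if "j < k" for j
      by (rule measurable_compose[OF measurable_fst measurable_gauss_vec_component[OF that]])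
    have Z [measurable]: "Z i \<in> borel_measurable ?N" for i
      unfolding Z_def[abs_def] half_norm2_def by measurable
    have Z_nonneg: "0 \<le> Z i \<omega>" for i \<omega> by (simp add: Z_def half_norm2_nonneg)
    have monom_exp: "monom_val n s (\<lambda>i. exp (- y i)) = exp (- (\<Sum>i<n. real (s i) * y i))" for n s y
      by (simp add: monom_val_def exp_of_nat_mult[symmetric] exp_sum sum_negf[symmetric])
    have bounded: "dual_bounded n (\<epsilon> m) (\<lambda>s. (\<integral>\<omega>. monom_val n s (\<lambda>i. exp (- Y i \<omega>)) \<partial>M)
        - (\<integral>\<omega>. monom_val n s (\<lambda>i. exp (- Z i \<omega>)) \<partial>?N))" for n
    proof -
      have tail: "(\<Sum>i<Suc n. (1 - F i) / L i) \<le> \<delta> m" "(\<Sum>i<Suc n. (1 - G i) / L i) \<le> \<delta> m" for n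
      proof -
        have "(\<Sum>i<Suc n. (1 - F i) / L i) = (\<Sum>i<n. hf (i + m))"
          unfolding sum.lessThan_Suc_shift by (simp add: F_def L_def hf_def add.commute)
        also have "\<dots> \<le> (\<Sum>i. hf (i + m))"
          by (rule sum_le_suminf) (use hf summable_ignore_initial_segment in auto)
        finally show "(\<Sum>i<Suc n. (1 - F i) / L i) \<le> \<delta> m" by (simp add: \<delta>_def)
        have "(\<Sum>i<Suc n. (1 - G i) / L i) = (\<Sum>i<n. hg (i + m))"
          unfolding sum.lessThan_Suc_shift by (simp add: G_def L_def hg_def add.commute)
        also have "\<dots> \<le> (\<Sum>i. hg (i + m))"
          by (rule sum_le_suminf) (use hg summable_ignore_initial_segment in auto)
        finally show "(\<Sum>i<Suc n. (1 - G i) / L i) \<le> \<delta> m" by (simp add: \<delta>_def)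
      qed
      show ?thesis
      proof (cases n)
        \<comment> \<open>With no coordinates every monomial is 1 and the two integrals agree, so
          only \<open>0 \<le> \<epsilon> m\<close> has to be shown.\<close>
        case 0
        have "0 \<le> \<delta> m" using tail(1)[of 0] by (simp add: F_def)
        then have "(1 - 10 * \<delta> m) powr \<alpha> \<le> 1 powr \<alpha>" using \<delta>m \<alpha> by (intro powr_mono2) auto
        then have "0 \<le> \<epsilon> m" using \<delta>m by (simp add: \<epsilon>_def powr_minus_divide field_simps)
        moreover have "measure ?N (space ?N) = 1" by (rule VS.P.prob_space)
        ultimately show ?thesis
          using dual_bounded_mono[OF dual_bounded_const[of 0 0]] 0
          by (simp add: monom_val_def M.prob_space)
      next
        case (Suc n')
        then have n: "0 < n" "1 \<le> n" by auto
        show ?thesis unfolding \<epsilon>_def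
        proof (rule dual_bounded_permanental_diff[where L = L and F = F and G = G, OF L F G _ _ \<delta>m n(1)])
          show "(\<Sum>i<n. (1 - F i) / L i) \<le> \<delta> m" "(\<Sum>i<n. (1 - G i) / L i) \<le> \<delta> m"
            using tail[of n'] Suc by auto
          show "dual_bounded n 1 (\<lambda>s. \<integral>\<omega>. monom_val n s (\<lambda>i. exp (- Z i \<omega>)) \<partial>?N)"
            by (rule VS.P.dual_bounded_laplace) (use Z Z_nonneg in auto)
          fix s :: "nat \<Rightarrow> nat"
          have p: "1 + L i * real (s i) \<noteq> 0" for i
            using L_nonneg[of i] by (simp add: add_pos_nonneg less_imp_neq[symmetric])
          have "(\<integral>\<omega>. monom_val n s (\<lambda>i. exp (- Y i \<omega>)) \<partial>M) = 1 / Determinant.det (1\<^sub>m n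
              + Matrix.mat n n (\<lambda>(i, j). L i * (if i = j then 1 else 0) + 1 + F i * G j)
                * mat_diag n (\<lambda>i. real (s i))) powr \<alpha>"
            unfolding monom_exp using vec[OF n(2)] by (simp add: M.permanental_vector_def)
          then show "(\<integral>\<omega>. monom_val n s (\<lambda>i. exp (- Y i \<omega>)) \<partial>M)
              = 1 / ((\<Prod>i<n. 1 + L i * real (s i)) *
                ((1 + (\<Sum>i<n. real (s i) / (1 + L i * real (s i)))) *
                 (1 + (\<Sum>i<n. real (s i) / (1 + L i * real (s i)) * F i * G i)) -
                 (\<Sum>i<n. real (s i) / (1 + L i * real (s i)) * F i) *
                 (\<Sum>i<n. real (s i) / (1 + L i * real (s i)) * G i))) powr \<alpha>"
            by (simp only: det_one_plus_rank_two_kernel[OF p])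
          have "(\<integral>\<omega>. monom_val n s (\<lambda>i. exp (- Z i \<omega>)) \<partial>?N)
              = enn2real (\<integral>\<^sup>+\<omega>. ennreal (exp (- (\<Sum>i<n. real (s i) * Z i \<omega>))) \<partial>?N)"
            unfolding monom_exp by (rule integral_eq_nn_integral) auto
          also have "(\<integral>\<^sup>+\<omega>. ennreal (exp (- (\<Sum>i<n. real (s i) * Z i \<omega>))) \<partial>?N)
              = ennreal (1 / ((\<Prod>i<n. 1 + L i * real (s i)) *
                (1 + 2 * (\<Sum>i<n. real (s i) / (1 + L i * real (s i))))) powr \<alpha>)"
            unfolding Z_def \<alpha>_def by (rule nn_integral_noncentral_laplace) (auto simp: L_nonneg)
          finally show "(\<integral>\<omega>. monom_val n s (\<lambda>i. exp (- Z i \<omega>)) \<partial>?N)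
              = 1 / ((\<Prod>i<n. 1 + L i * real (s i)) *
                (1 + 2 * (\<Sum>i<n. real (s i) / (1 + L i * real (s i))))) powr \<alpha>"
            by simp
        qed (simp, rule \<alpha>)
      qed
    qed
    \<comment> \<open>Position \<open>Suc n\<close> of \<open>y\<close> carries the index
      \<open>Suc m + Suc n = n + (m + 2)\<close> of the original sequence.\<close>
    define q where "q y n = (y (Suc n) - y 0) / sqrt (l (n + (m + 2)) * ln (real (n + (m + 2))))"
      for y :: "nat \<Rightarrow> real" and n
    define E where "E = {y \<in> space (Pi\<^sub>M UNIV (\<lambda>_::nat. borel)). lims (y 0) (q y)}"
    have [measurable]: "(\<lambda>y. y i) \<in> borel_measurable (Pi\<^sub>M UNIV (\<lambda>_::nat. borel :: real measure))" for i
      by (rule measurable_component_singleton) simp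
    have [measurable]: "(\<lambda>y. q y n) \<in> borel_measurable (Pi\<^sub>M UNIV (\<lambda>_::nat. borel))" for n
      unfolding q_def by measurable
    have E [measurable]: "E \<in> sets (Pi\<^sub>M UNIV (\<lambda>_::nat. borel))"
      unfolding E_def lims_def
      by (rule sets_Collect_limsup_liminf[where q = "\<lambda>n y. q y n"]) measurable
    have A_eq: "{\<omega> \<in> space M. (\<lambda>i. Y i \<omega>) \<in> E} = A"
    proof -
      have qY: "q (\<lambda>i. Y i \<omega>) = (\<lambda>n. qX \<omega> (n + (m + 2)))" for \<omega>
        by (simp add: q_def qX_def Y_def h_def fun_eq_iff add.commute)
      have "lims (Y 0 \<omega>) (q (\<lambda>i. Y i \<omega>)) \<longleftrightarrow> lims (X 0 \<omega>) (qX \<omega>)" for \<omega>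
        unfolding qY lims_shift by (simp add: Y_def h_def)
      then show ?thesis by (simp add: E_def A_def space_PiM)
    qed
    have [measurable]: "(\<lambda>\<omega> i. Y i \<omega>) \<in> measurable M (Pi\<^sub>M UNIV (\<lambda>_::nat. borel))"
      by (rule measurable_PiM_single') auto
    have [measurable]: "(\<lambda>\<omega> i. Z i \<omega>) \<in> measurable ?N (Pi\<^sub>M UNIV (\<lambda>_::nat. borel))"
      by (rule measurable_PiM_single') auto
    have "{\<omega> \<in> space M. (\<lambda>i. Y i \<omega>) \<in> E} \<in> sets M" by measurable
    then have "A \<in> sets M" unfolding A_eq .
    moreover have "AE \<omega> in ?N. (\<lambda>i. Z i \<omega>) \<in> E"
    proof (rule VS.AE_pair_measure)
      show "{\<omega> \<in> space ?N. (\<lambda>i. Z i \<omega>) \<in> E} \<in> sets ?N" by measurable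
      \<comment> \<open>By Fubini the common vector may be frozen, which is the situation with fixed
        \<open>z = sqrt 2 * \<eta>\<close>.\<close>
      have "AE \<xi> in gauss_seq k. (\<lambda>i. Z i (\<eta>, \<xi>)) \<in> E" for \<eta>
      proof -
        let ?z = "\<lambda>j. sqrt 2 * \<eta> j"
        let ?Q = "\<lambda>\<xi> n. (half_norm2 k (\<lambda>j. sqrt (l n) * \<xi> n j + ?z j) - half_norm2 k ?z) / sqrt (l n * ln (real n))"
        have "AE \<xi> in gauss_seq k. lims (half_norm2 k ?z) (?Q \<xi>)"
          unfolding lims_def by (rule AE_gauss_seq_limits[OF k _ l_log_lim]) (rule l_pos)
        then show ?thesis
        proof eventually_elim
          case (elim \<xi>)
          have qZ: "q (\<lambda>i. Z i (\<eta>, \<xi>)) = (\<lambda>n. ?Q \<xi> (n + (m + 2)))"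
            by (simp add: q_def Z_def L_def fun_eq_iff add.commute)
          have "lims (half_norm2 k ?z) (q (\<lambda>i. Z i (\<eta>, \<xi>)))"
            unfolding qZ using elim lims_shift[of _ "?Q \<xi>"] by blast
          moreover have "Z 0 (\<eta>, \<xi>) = half_norm2 k ?z" by (simp add: Z_def L_def)
          ultimately show ?case by (simp add: E_def space_PiM)
        qed
      qed
      then show "AE \<eta> in gauss_vec k. AE \<xi> in gauss_seq k. (\<lambda>i. Z i (\<eta>, \<xi>)) \<in> E" by simp
    qed
    then have "measure ?N {\<omega> \<in> space ?N. (\<lambda>i. Z i \<omega>) \<in> E} = 1"
      by (subst VS.P.prob_Collect_eq_1) auto
    moreover have "measure ?N {\<omega> \<in> space ?N. (\<lambda>i. Z i \<omega>) \<in> E} \<le> measure M {\<omega> \<in> space M. (\<lambda>i. Y i \<omega>) \<in> E} + \<epsilon> m"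
      by (rule measure_le_of_dual_bounded[OF M VS.P.prob_space_axioms Y Y_nonneg Z Z_nonneg bounded E])
    ultimately show ?thesis unfolding A_eq by simp
  qed
  have ev: "\<forall>\<^sub>F m in sequentially. \<delta> m < 1 / 10"
    using order_tendstoD(2)[OF \<delta>_lim, of "1 / 10"] by simp
  then obtain m0 where "\<delta> m0 < 1 / 10" using eventually_happens'[OF sequentially_bot] by blast
  then have A: "A \<in> sets M" using main by blast
  \<comment> \<open>Because \<open>A\<close> does not depend on \<open>m\<close>, letting
    \<open>m\<close> grow removes the error.\<close>
  have "(\<lambda>m. measure M A + \<epsilon> m) \<longlonglongrightarrow> measure M A + 0" by (intro tendsto_intros \<epsilon>_lim)
  then have "1 \<le> measure M A + 0"
    by (rule tendsto_lowerbound) (use ev main in \<open>auto elim!: eventually_mono\<close>)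
  then have "measure M A = 1" using M.prob_le_1[of A] by linarith
  then have AE_A: "AE \<omega> in M. \<omega> \<in> A" using A M.prob_eq_1 by blast
  have abs_qX: "\<bar>qX \<omega> n\<bar> = \<bar>X (1 / real n) \<omega> - X 0 \<omega>\<bar> / sqrt (l n * ln (real n))" for \<omega> n
  proof -
    \<comment> \<open>The sign of \<open>l n\<close> is known only from index 2 on; at 0 and 1 the
      logarithm is 0.\<close>
    have "0 \<le> l n * ln (real n)"
    proof (cases "n < 2")
      case True
      then have "n = 0 \<or> n = 1" by auto
      then show ?thesis by auto
    qed (use l_pos[of n] in auto)
    then show ?thesis by (simp add: qX_def)
  qed
  show ?thesis
    using AE_A by eventually_elim (unfold A_def lims_def abs_qX, simp add: qX_def)
qed

end
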